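(* The Maximum $2$-Transitivity Problem can be solved in linear time for bipartite chain graphs; that is, there is an algorithm running in linear time that, given a bipartite chain graph $G$, solves the problem of finding a $2$-transitive partition of $G$ with the maximum number of parts, the maximum number of parts being $Tr_2(G)$.
   Context: Graphs are finite, simple and undirected. For disjoint $A,B\subseteq V$, $A$ $2$-dominates $B$ if every vertex of $B$ is adjacent to at least two vertices of $A$. A $2$-transitive partition of size $k$ of $G=(V,E)$ is a partition $\{V_1,\ldots,V_k\}$ of $V$ into $k$ nonempty (ordered) parts such that $V_i$ $2$-dominates $V_j$ for all $1\leq i<j\leq k$. The $2$-transitivity $Tr_2(G)$ is the maximum size of a $2$-transitive partition of $G$. The Maximum $2$-Transitivity Problem is: given a graph $G$, find a $2$-transitive partition of $G$ of maximum order. A bipartite graph $G=(X\cup Y,E)$ is a bipartite chain graph if there are orderings $(x_1,\ldots,x_m)$ of $X$ and $(y_1,\ldots,y_n)$ of $Y$ such that $N(x_m)\subseteq N(x_{m-1})\subseteq\cdots\subseteq N(x_1)$ and $N(y_n)\subseteq N(y_{n-1})\subseteq\cdots\subseteq N(y_1)$, where $N(v)$ is the set of neighbours of $v$. Linear time means $O(|V|+|E|)$. *)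

theory Defs
  imports Complex_Main "HOL-Library.Landau_Symbols" "HOL-Library.Disjoint_Sets"
begin

section \<open>Graphs and 2-transitive partitions\<close>

definition simple_graph :: "'a set \<Rightarrow> 'a set set \<Rightarrow> bool" where
  "simple_graph V E \<longleftrightarrow> finite V \<and> (\<forall>e\<in>E. e \<subseteq> V \<and> card e = 2)"

definition nbhd :: "'a set set \<Rightarrow> 'a \<Rightarrow> 'a set" where
  "nbhd E v = {w. {v, w} \<in> E}"

definition two_dominates :: "'a set set \<Rightarrow> 'a set \<Rightarrow> 'a set \<Rightarrow> bool" where
  "two_dominates E A B \<longleftrightarrow> (\<forall>v\<in>B. 2 \<le> card (A \<inter> nbhd E v))"

text \<open>The ordered partition \<open>V\<^sub>1, \<dots>, V\<^sub>k\<close> is the list \<open>Vs\<close> of length \<open>k\<close>.\<close>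

definition two_transitive_partition :: "'a set \<Rightarrow> 'a set set \<Rightarrow> 'a set list \<Rightarrow> bool" where
  "two_transitive_partition V E Vs \<longleftrightarrow>
     partition_on V (set Vs) \<and> distinct Vs \<and> sorted_wrt (two_dominates E) Vs"

definition Tr2 :: "'a set \<Rightarrow> 'a set set \<Rightarrow> nat" where
  "Tr2 V E = Max {length Vs | Vs. two_transitive_partition V E Vs}"

definition bipartition :: "'a set \<Rightarrow> 'a set set \<Rightarrow> 'a set \<Rightarrow> 'a set \<Rightarrow> bool" where
  "bipartition V E X Y \<longleftrightarrow>
     X \<union> Y = V \<and> X \<inter> Y = {} \<and> (\<forall>e\<in>E. \<exists>x\<in>X. \<exists>y\<in>Y. e = {x, y})"

definition bipartite_chain_graph :: "'a set \<Rightarrow> 'a set set \<Rightarrow> bool" where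
  "bipartite_chain_graph V E \<longleftrightarrow> simple_graph V E \<and>
     (\<exists>xs ys. distinct xs \<and> distinct ys \<and> bipartition V E (set xs) (set ys) \<and>
        sorted_wrt (\<lambda>u v. nbhd E v \<subseteq> nbhd E u) xs \<and>
        sorted_wrt (\<lambda>u v. nbhd E v \<subseteq> nbhd E u) ys)"


section \<open>Algorithms and their running time\<close>

text \<open>
  The machine model is a unit-cost random access machine, programmed in a while-language with
  natural-number registers and arrays. Every node of an evaluated expression and every executed
  command costs one step. The only operations on numbers are successor, truncated subtraction and
  comparison, so within \<open>t\<close> steps no number exceeds the largest number in the program and
  the initial memory by more than \<open>t\<close>; hence unit cost cannot be exploited by computing with huge
  numbers.
\<close>

type_synonym name = string

datatype aexp =
    Lit nat
  | Var name
  | Read name aexp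
  | Succ aexp
  | Minus aexp aexp

datatype bexp =
    Less aexp aexp
  | Not bexp
  | And bexp bexp

datatype com =
    Skip
  | Assign name aexp
  | Write name aexp aexp
  | Seq com com
  | Cond bexp com com
  | While bexp com

record state =
  reg :: "name \<Rightarrow> nat"
  arr :: "name \<Rightarrow> nat \<Rightarrow> nat"

fun aval :: "aexp \<Rightarrow> state \<Rightarrow> nat" where
  "aval (Lit k) s = k"
| "aval (Var x) s = reg s x"
| "aval (Read a e) s = arr s a (aval e s)"
| "aval (Succ e) s = Suc (aval e s)"
| "aval (Minus e e') s = aval e s - aval e' s"

fun acost :: "aexp \<Rightarrow> nat" where
  "acost (Lit k) = 1"
| "acost (Var x) = 1"
| "acost (Read a e) = acost e + 1"
| "acost (Succ e) = acost e + 1"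
| "acost (Minus e e') = acost e + acost e' + 1"

fun bval :: "bexp \<Rightarrow> state \<Rightarrow> bool" where
  "bval (Less e e') s \<longleftrightarrow> aval e s < aval e' s"
| "bval (Not b) s \<longleftrightarrow> \<not> bval b s"
| "bval (And b b') s \<longleftrightarrow> bval b s \<and> bval b' s"

fun bcost :: "bexp \<Rightarrow> nat" where
  "bcost (Less e e') = acost e + acost e' + 1"
| "bcost (Not b) = bcost b + 1"
| "bcost (And b b') = bcost b + bcost b' + 1"

text \<open>\<open>exec c s t s'\<close>: started in \<open>s\<close>, the program \<open>c\<close> halts after exactly \<open>t\<close> steps in \<open>s'\<close>.\<close>

inductive exec :: "com \<Rightarrow> state \<Rightarrow> nat \<Rightarrow> state \<Rightarrow> bool" where
  Skip: "exec Skip s 1 s"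
| Assign: "exec (Assign x e) s (acost e + 1) (s\<lparr>reg := (reg s)(x := aval e s)\<rparr>)"
| Write: "exec (Write a i e) s (acost i + acost e + 1)
            (s\<lparr>arr := (arr s)(a := (arr s a)(aval i s := aval e s))\<rparr>)"
| Seq: "exec c s t s' \<Longrightarrow> exec c' s' t' s'' \<Longrightarrow> exec (Seq c c') s (t + t' + 1) s''"
| CondTrue: "bval b s \<Longrightarrow> exec c s t s' \<Longrightarrow> exec (Cond b c c') s (bcost b + t + 1) s'"
| CondFalse: "\<not> bval b s \<Longrightarrow> exec c' s t s' \<Longrightarrow> exec (Cond b c c') s (bcost b + t + 1) s'"
| WhileFalse: "\<not> bval b s \<Longrightarrow> exec (While b c) s (bcost b + 1) s"
| WhileTrue: "bval b s \<Longrightarrow> exec c s t s' \<Longrightarrow> exec (While b c) s' t' s'' \<Longrightarrow>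
    exec (While b c) s (bcost b + t + t' + 1) s''"

inductive_cases SkipE: "exec Skip s t s'"
  and AssignE: "exec (Assign x e) s t s'"
  and WriteE: "exec (Write a i e) s t s'"
  and SeqE: "exec (Seq c c') s t s'"
  and CondE: "exec (Cond b c c') s t s'"
  and WhileE: "exec (While b c) s t s'"

text \<open>The final state and the running time are determined by the program and the initial state.\<close>

lemma exec_deterministic:
  "exec c s t s' \<Longrightarrow> exec c s t' s'' \<Longrightarrow> t' = t \<and> s'' = s'"
proof (induction arbitrary: t' s'' rule: exec.induct)
  case (Skip s)
  from Skip.prems show ?case by (rule SkipE) simp
next
  case (Assign x e s)
  from Assign.prems show ?case by (rule AssignE) simp
next
  case (Write a i e s)
  from Write.prems show ?case by (rule WriteE) simp
next
  case (Seq c s t1 s1 c' t2 s2)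
  from Seq.prems obtain u1 r u2
    where t': "t' = Suc (u1 + u2)" and c: "exec c s u1 r" and c': "exec c' r u2 s''"
    by (rule SeqE)
  from Seq.IH(1)[OF c] have "u1 = t1" "r = s1" by simp_all
  with Seq.IH(2) c' t' show ?case by simp
next
  case (CondTrue b s c t1 s1 c')
  from CondTrue.prems obtain u where "t' = Suc (bcost b + u)" "exec c s u s''"
    by (rule CondE) (use CondTrue.hyps in blast)+
  with CondTrue.IH show ?case by simp
next
  case (CondFalse b s c' t1 s1 c)
  from CondFalse.prems obtain u where "t' = Suc (bcost b + u)" "exec c' s u s''"
    by (rule CondE) (use CondFalse.hyps in blast)+
  with CondFalse.IH show ?case by simp
next
  case (WhileFalse b s c)
  from WhileFalse.prems show ?case by (rule WhileE) (use WhileFalse.hyps in simp_all)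
next
  case (WhileTrue b s c t1 s1 t2 s2)
  from WhileTrue.prems obtain u1 r u2
    where t': "t' = Suc (bcost b + u1 + u2)" and c: "exec c s u1 r"
      and w: "exec (While b c) r u2 s''"
    by (rule WhileE) (use WhileTrue.hyps in blast)+
  from WhileTrue.IH(1)[OF c] have "u1 = t1" "r = s1" by simp_all
  with WhileTrue.IH(2) w t' show ?case by simp
qed


section \<open>Input and output\<close>

text \<open>
  An input graph has vertex set \<open>{..<n}\<close> and is given by adjacency lists, in no particular order:
  \<open>adj ! v\<close> lists the neighbours of \<open>v\<close>. No bipartition is supplied.
\<close>

definition adjacency_lists :: "nat \<Rightarrow> nat set set \<Rightarrow> nat list list \<Rightarrow> bool" where
  "adjacency_lists n E adj \<longleftrightarrow>
     length adj = n \<and> (\<forall>v<n. distinct (adj ! v) \<and> set (adj ! v) = nbhd E v)"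

definition array_of :: "nat list \<Rightarrow> nat \<Rightarrow> nat" where
  "array_of xs i = (if i < length xs then xs ! i else 0)"

text \<open>
  The adjacency lists are stored one after the other: the neighbours of \<open>v\<close> occupy the cells of
  \<open>adj\<close> from \<open>start[v]\<close> up to, but excluding, \<open>start[v + 1]\<close>. All other memory is \<open>0\<close>.
\<close>

definition input_state :: "nat list list \<Rightarrow> state" where
  "input_state adj =
     \<lparr>reg = (\<lambda>_. 0)(''n'' := length adj),
      arr = (\<lambda>_ _. 0)
        (''start'' := array_of (map (\<lambda>v. length (concat (take v adj))) [0..<length adj + 1]),
         ''adj'' := array_of (concat adj))\<rparr>"

text \<open>
  The output is the number \<open>k\<close> of parts and, for every vertex \<open>v\<close>, the index \<open>part[v]\<close> of its part.
\<close>

definition output_parts :: "nat \<Rightarrow> state \<Rightarrow> nat set list" where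
  "output_parts n s = map (\<lambda>j. {v. v < n \<and> arr s ''part'' v = j}) [1..<reg s ''k'' + 1]"

end

theory Submission
  imports Defs
begin

text \<open>
  In a bipartite chain graph the degrees order the neighbourhoods on each side by inclusion, so the
  possible numbers of parts can be read off from the degree counts of the two sides. Suppose that
  there are \<open>k \<ge> 2\<close> parts and that the last part contains a vertex \<open>v\<close> of side \<open>b\<close>. Then each earlier
  part has two neighbours of \<open>v\<close> on the other side, and, seen from such a neighbour in the part before
  the last, each of the first \<open>k - 2\<close> parts also has two vertices on side \<open>b\<close>. Because
  neighbourhoods are nested, the two vertices of largest degree serve every vertex that has two
  neighbours there (\<open>crown_exists\<close>). Keeping only them leaves \<open>2k - 3\<close> vertices on side \<open>b\<close> and
  \<open>2k - 2\<close> on the other side, where two vertices on different sides can only fail to be adjacent if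
  they lie in the same part. The kept vertex of least degree on either side is therefore adjacent to
  all but two of the kept vertices of the opposite side, and these inherit, by nesting, adjacency to
  everything kept on its side. This gives at least \<open>2k - 5\<close> vertices of degree \<open>\<ge> 2k - 2\<close> on side \<open>b\<close>
  and at least \<open>2k - 4\<close> vertices of degree \<open>\<ge> 2k - 3\<close> on the other one (\<open>partition_supports\<close>);
  for \<open>k = 2\<close> there is still \<open>v\<close>, so that \<open>2k - 5\<close> is to be read as \<open>1\<close>.

  Conversely these counts suffice. Take \<open>max 1 (2k - 5)\<close> vertices of degree \<open>\<ge> 2k - 2\<close> on side \<open>b\<close>, and let \<open>w\<close>
  be one of least degree among them. Enough neighbours of \<open>w\<close> have degree \<open>\<ge> 2k - 3\<close>
  (\<open>partners_available\<close>); take \<open>2k - 4\<close> of them. All the chosen vertices on the two sides are adjacent,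
  and each has two further neighbours that were not chosen. So the chosen vertices can be spread over
  the parts \<open>2, \<dots>, k\<close>, two of each side per part except in the last two parts, and all the others form the first part
  (\<open>two_transitive_layering\<close>). No sorting is needed.

  The program finds the sides first: the neighbourhood of a vertex of maximum degree consists of all
  non-isolated vertices of the opposite side (\<open>chain_bigraph_of_max_degree\<close>). The numbers of
  vertices of degree at least \<open>d\<close> on each side are obtained, for all \<open>d\<close> at once, by
  incrementing a counter per cell of the adjacency lists. Then \<open>k\<close> grows while the counts allow it, and
  one scan of the vertices and one scan of the neighbours of \<open>w\<close> choose and place the vertices. Each
  loop runs in time proportional to the number of vertices or of cells, and there are two cells per edge.
\<close>

section \<open>The possible numbers of parts in a chain graph\<close>

text \<open>
  A bipartition is recorded by the set \<open>S\<close> of the vertices on one of its sides, so that a side is a truth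
  value and both sides can be treated by the same lemmas.
\<close>

locale chain_bigraph =
  fixes V :: "'a set" and E :: "'a set set" and S :: "'a set"
  assumes finite_V: "finite V"
    and nbhd_V: "nbhd E v \<subseteq> V"
    and crossing: "w \<in> nbhd E v \<Longrightarrow> w \<in> S \<longleftrightarrow> v \<notin> S"
    and nested: "(u \<in> S) = (v \<in> S) \<Longrightarrow> nbhd E u \<subseteq> nbhd E v \<or> nbhd E v \<subseteq> nbhd E u"
begin

abbreviation N :: "'a \<Rightarrow> 'a set" where "N \<equiv> nbhd E"

definition rich :: "bool \<Rightarrow> nat \<Rightarrow> 'a set" where
  "rich b d = {v \<in> V. (v \<in> S) = b \<and> d \<le> card (N v)}"

text \<open>
  The degree condition for \<open>k \<ge> 2\<close> parts with a vertex of side \<open>b\<close> in the last part. For \<open>k = 2\<close> the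
  truncated \<open>2 * k - 5\<close> is \<open>0\<close> although the last part needs a vertex; hence the first conjunct.
\<close>

definition supports :: "bool \<Rightarrow> nat \<Rightarrow> bool" where
  "supports b k \<longleftrightarrow> 1 \<le> card (rich b (2 * k - 2)) \<and> 2 * k - 5 \<le> card (rich b (2 * k - 2)) \<and>
     2 * k - 4 \<le> card (rich (\<not> b) (2 * k - 3))"

lemma finite_N [simp]: "finite (N v)"
  using finite_V nbhd_V finite_subset by blast

lemma finite_rich [simp]: "finite (rich b d)"
  using finite_V by (simp add: rich_def)

lemma nbhd_sym: "w \<in> N v \<longleftrightarrow> v \<in> N w"
  by (simp add: nbhd_def insert_commute)

lemma nested_by_degree:
  assumes "(u \<in> S) = (v \<in> S)" "card (N u) \<le> card (N v)"
  shows "N u \<subseteq> N v"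
  using nested[OF assms(1)] assms(2) card_seteq[of "N u" "N v"] by auto

lemma least_degree_exists:
  assumes "finite A" "A \<noteq> {}"
  obtains a where "a \<in> A" "\<And>x. x \<in> A \<Longrightarrow> card (N a) \<le> card (N x)"
proof -
  let ?M = "Min ((\<lambda>x. card (N x)) ` A)"
  have "?M \<in> (\<lambda>x. card (N x)) ` A" using assms by (intro Min_in) auto
  then obtain a where "a \<in> A" "card (N a) = ?M" by auto
  then show thesis using that[of a] assms(1) by auto
qed

lemma greatest_degree_exists:
  assumes "finite A" "A \<noteq> {}"
  obtains a where "a \<in> A" "\<And>x. x \<in> A \<Longrightarrow> card (N x) \<le> card (N a)"
proof -
  let ?M = "Max ((\<lambda>x. card (N x)) ` A)"
  have "?M \<in> (\<lambda>x. card (N x)) ` A" using assms by (intro Max_in) auto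
  then obtain a where "a \<in> A" "card (N a) = ?M" by auto
  then show thesis using that[of a] assms(1) by auto
qed

text \<open>
  A crown of \<open>W\<close> is a pair of vertices that can stand for \<open>W\<close> in every domination requirement coming
  from the opposite side.
\<close>

definition crown :: "'a set \<Rightarrow> bool \<Rightarrow> 'a set \<Rightarrow> bool" where
  "crown W b A \<longleftrightarrow> A \<subseteq> W \<and> card A = 2 \<and> (\<forall>x\<in>A. (x \<in> S) = b) \<and>
     (\<forall>y. (y \<in> S) = (\<not> b) \<longrightarrow> 2 \<le> card (W \<inter> N y) \<longrightarrow> A \<subseteq> N y)"

text \<open>
  Take a vertex \<open>a\<close> of largest degree in the half of \<open>W\<close> opposite to \<open>z\<close> and then \<open>b\<close> of largest degree in
  the rest of that half. If \<open>y\<close> has two neighbours in \<open>W\<close>, the neighbourhood of either is contained in that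
  of \<open>a\<close>, and the neighbourhood of one that differs from \<open>a\<close> is contained in that of \<open>b\<close>.
\<close>

lemma crown_exists:
  assumes "W \<subseteq> V" "2 \<le> card (W \<inter> N z)"
  shows "\<exists>A. crown W (z \<notin> S) A"
proof -
  let ?W = "{x \<in> W. (x \<in> S) = (z \<notin> S)}"
  have fin: "finite ?W" using assms(1) finite_V finite_subset by fastforce
  have sub: "W \<inter> N y \<subseteq> ?W" if "(y \<in> S) = (z \<in> S)" for y
    using crossing that by blast
  have W2: "2 \<le> card ?W" using assms(2) card_mono[OF fin sub[of z]] by simp
  then have ne: "?W \<noteq> {}" by force
  obtain a where a: "a \<in> ?W" "\<And>x. x \<in> ?W \<Longrightarrow> card (N x) \<le> card (N a)"
    by (rule greatest_degree_exists[OF fin ne]) blast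
  have "card (?W - {a}) \<ge> 1" using W2 a fin by (simp add: card_Diff_singleton)
  then have ne_a: "?W - {a} \<noteq> {}" by force
  obtain b where b: "b \<in> ?W - {a}" "\<And>x. x \<in> ?W - {a} \<Longrightarrow> card (N x) \<le> card (N b)"
    by (rule greatest_degree_exists[OF finite_Diff[OF fin] ne_a]) blast
  have "{a, b} \<subseteq> N y" if y: "(y \<in> S) = (z \<in> S)" "2 \<le> card (W \<inter> N y)" for y
  proof -
    have "card {} < card (W \<inter> N y)" "card {a} < card (W \<inter> N y)" using y(2) by auto
    moreover have "\<not> W \<inter> N y \<subseteq> {}"
      using \<open>card {} < card (W \<inter> N y)\<close> by (metis less_irrefl subset_empty)
    moreover have "\<not> W \<inter> N y \<subseteq> {a}"
      using \<open>card {a} < card (W \<inter> N y)\<close> card_mono[of "{a}" "W \<inter> N y"] by fastforce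
    ultimately obtain c d where c: "c \<in> W \<inter> N y" and d: "d \<in> W \<inter> N y" "d \<noteq> a" by blast
    have "N c \<subseteq> N a" using nested_by_degree[of c a] a c sub[OF y(1)] by blast
    moreover have "N d \<subseteq> N b" using nested_by_degree[of d b] b d sub[OF y(1)] by blast
    ultimately show ?thesis using c d nbhd_sym by blast
  qed
  moreover have "card {a, b} = 2" using b by auto
  ultimately show ?thesis using a(1) b(1) unfolding crown_def by (intro exI[of _ "{a, b}"]) auto
qed

text \<open>
  Only the last \<open>k\<close> parts matter, and in each of them only a crown on each side. The lists of indices
  differ for the two sides: the part before the last one has a crown on side \<open>\<not> b\<close> only, and the
  last one is represented by the single vertex \<open>v\<close>.
\<close>

lemma partition_supports:
  assumes P: "two_transitive_partition V E Vs" and k: "2 \<le> k" "k \<le> length Vs"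
  shows "\<exists>b. supports b k"
proof -
  define W where "W i = Vs ! (length Vs - k + i)" for i
  have W_in: "W i \<in> set Vs" if "i < k" for i using that k by (simp add: W_def)
  have W_V: "W i \<subseteq> V" if "i < k" for i
    using W_in[OF that] P unfolding two_transitive_partition_def by (auto dest: partition_onD1)
  have W_disj: "W i \<inter> W j = {}" if "i < k" "j < k" "i \<noteq> j" for i j
  proof -
    have "W i \<noteq> W j"
      using that k P by (simp add: W_def two_transitive_partition_def nth_eq_iff_index_eq)
    then show ?thesis
      using W_in[OF that(1)] W_in[OF that(2)] P
      unfolding two_transitive_partition_def by (auto dest: partition_onD2 disjointD)
  qed
  have W_dom: "2 \<le> card (W i \<inter> N v)" if "i < j" "j < k" "v \<in> W j" for i j v
  proof -
    have "two_dominates E (W i) (W j)"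
      using that(1,2) P k unfolding two_transitive_partition_def sorted_wrt_iff_nth_less W_def
      by (elim conjE allE[of _ "length Vs - k + i"] allE[of _ "length Vs - k + j"]) auto
    then show ?thesis using that(3) unfolding two_dominates_def by blast
  qed
  have W_ne: "W i \<noteq> {}" if "i < k" for i
    using W_in[OF that] P unfolding two_transitive_partition_def by (auto dest: partition_onD3)
  obtain r where r: "k = Suc (Suc r)" using that[of "k - 2"] k by simp
  obtain v where v: "v \<in> W (Suc r)" using W_ne[of "Suc r"] r by auto
  define b where "b \<longleftrightarrow> v \<in> S"
  have "\<exists>A. crown (W i) (\<not> b) A" if "i < Suc r" for i
    unfolding b_def using crown_exists[OF W_V[of i] W_dom[of i "Suc r" v]] v that r by simp
  then obtain B where B: "\<And>i. i < Suc r \<Longrightarrow> crown (W i) (\<not> b) (B i)" by metis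
  have B_W: "B i \<subseteq> W i" and B_card: "card (B i) = 2" if "i < Suc r" for i
    using B[OF that] unfolding crown_def by simp_all
  have B_side: "(x \<in> S) = (\<not> b)" if "i < Suc r" "x \<in> B i" for i x
    using B[OF that(1)] that(2) unfolding crown_def by simp
  have B_top: "B i \<subseteq> N y" if "i < Suc r" "(y \<in> S) = b" "2 \<le> card (W i \<inter> N y)" for i y
    using B[OF that(1)] that(2,3) unfolding crown_def by simp
  have "B r \<noteq> {}" using B_card[of r] by force
  then obtain y where y: "y \<in> B r" by blast
  then have yW: "y \<in> W r" and yS: "(y \<in> S) = (\<not> b)" using B_W[of r] B_side[of r y] by auto
  have "\<exists>A. crown (W i) b A" if "i < r" for i
    using crown_exists[OF W_V[of i] W_dom[of i r y]] yW yS that r by simp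
  then obtain A where A: "\<And>i. i < r \<Longrightarrow> crown (W i) b (A i)" by metis
  have A_W: "A i \<subseteq> W i" and A_card: "card (A i) = 2" if "i < r" for i
    using A[OF that] unfolding crown_def by simp_all
  have A_side: "(x \<in> S) = b" if "i < r" "x \<in> A i" for i x
    using A[OF that(1)] that(2) unfolding crown_def by simp
  have A_top: "A i \<subseteq> N z" if "i < r" "(z \<in> S) = (\<not> b)" "2 \<le> card (W i \<inter> N z)" for i z
    using A[OF that(1)] that(2,3) unfolding crown_def by simp
  define AA where "AA = insert v (\<Union>i<r. A i)"
  define BB where "BB = (\<Union>i<Suc r. B i)"
  have finA: "finite (A i)" if "i < r" for i
    using A_card[OF that] by (metis card.infinite zero_neq_numeral)
  have finB: "finite (B i)" if "i < Suc r" for i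
    using B_card[OF that] by (metis card.infinite zero_neq_numeral)
  have v_notin: "v \<notin> A i" if "i < r" for i
    using W_disj[of i "Suc r"] A_W[OF that] v that r by auto
  have disjA: "A i \<inter> A j = {}" if "i < r" "j < r" "i \<noteq> j" for i j
    using A_W[OF that(1)] A_W[OF that(2)] W_disj[of i j] that r by auto
  have disjB: "B i \<inter> B j = {}" if "i < Suc r" "j < Suc r" "i \<noteq> j" for i j
    using B_W[OF that(1)] B_W[OF that(2)] W_disj[of i j] that r by auto
  have "card (\<Union>i<r. A i) = (\<Sum>i<r. card (A i))"
    by (rule card_UN_disjoint) (use finA disjA in auto)
  then have "card (\<Union>i<r. A i) = 2 * r" using A_card by simp
  moreover have "v \<notin> (\<Union>i<r. A i)" "finite (\<Union>i<r. A i)" using v_notin finA by auto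
  ultimately have card_AA: "card AA = 2 * k - 3"
    unfolding AA_def using r by (subst card_insert_disjoint) auto
  have "card BB = (\<Sum>i<Suc r. card (B i))" unfolding BB_def
    by (rule card_UN_disjoint) (use finB disjB in auto)
  also have "\<dots> = (\<Sum>i<Suc r. 2)" using B_card by (intro sum.cong) auto
  finally have card_BB: "card BB = 2 * k - 2" using r by simp
  have finAA: "finite AA" using finA by (auto simp: AA_def)
  have finBB: "finite BB" using finB by (auto simp: BB_def)
  have AA_side: "x \<in> V \<and> (x \<in> S) = b" if x: "x \<in> AA" for x
  proof (cases "x = v")
    case True then show ?thesis using v W_V[of "Suc r"] r by (auto simp: b_def)
  next
    case False
    then obtain i where "i < r" "x \<in> A i" using x unfolding AA_def by blast
    then show ?thesis using A_W[of i] A_side[of i x] W_V[of i] r by auto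
  qed
  have BB_side: "x \<in> V \<and> (x \<in> S) = (\<not> b)" if "x \<in> BB" for x
  proof -
    obtain i where "i < Suc r" "x \<in> B i" using \<open>x \<in> BB\<close> unfolding BB_def by blast
    then show ?thesis using B_W[of i] B_side[of i x] W_V[of i] r by auto
  qed
  \<comment> \<open>Vertices kept in different parts are adjacent: the one in the later part has two neighbours in the earlier part, hence is adjacent to its whole crown.\<close>
  have A_adj: "x \<in> N z" if x: "x \<in> A i" "i < r" and z: "z \<in> B j" "j < Suc r" and ne: "i \<noteq> j" for x z i j
  proof (cases "i < j")
    case True
    have "z \<in> W j" using B_W z by blast
    then have "2 \<le> card (W i \<inter> N z)" using W_dom[of i j z] True z r by simp
    then show ?thesis using A_top[OF x(2) B_side[OF z(2,1)]] x by blast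
  next
    case False
    have "x \<in> W i" using A_W x by blast
    then have "2 \<le> card (W j \<inter> N x)" using W_dom[of j i x] False ne x r by simp
    then have "B j \<subseteq> N x" using B_top[OF z(2) A_side[OF x(2,1)]] by blast
    then show ?thesis using z nbhd_sym by blast
  qed
  have v_adj: "v \<in> N z" if z: "z \<in> BB" for z
  proof -
    obtain j where j: "j < Suc r" "z \<in> B j" using z unfolding BB_def by blast
    then have "2 \<le> card (W j \<inter> N v)" using W_dom[of j "Suc r" v] v r by simp
    then have "B j \<subseteq> N v" using B_top[OF j(1), of v] b_def by simp
    then show ?thesis using j nbhd_sym by blast
  qed
  have BB_ne: "BB \<noteq> {}" using card_BB r by auto
  obtain y0 where y0: "y0 \<in> BB" "\<And>z. z \<in> BB \<Longrightarrow> card (N y0) \<le> card (N z)"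
    by (rule least_degree_exists[OF finBB BB_ne]) blast
  have AA_ne: "AA \<noteq> {}" unfolding AA_def by simp
  obtain x0 where x0: "x0 \<in> AA" "\<And>z. z \<in> AA \<Longrightarrow> card (N x0) \<le> card (N z)"
    by (rule least_degree_exists[OF finAA AA_ne]) blast
  \<comment> \<open>Nesting lifts adjacency to the vertex of least degree to adjacency to its whole side.\<close>
  have "AA \<inter> N y0 \<subseteq> rich b (2 * k - 2)"
  proof
    fix x assume x: "x \<in> AA \<inter> N y0"
    have "BB \<subseteq> N x"
    proof
      fix z assume z: "z \<in> BB"
      then have "N y0 \<subseteq> N z" using nested_by_degree[of y0 z] y0 BB_side by auto
      then show "z \<in> N x" using x nbhd_sym by blast
    qed
    then have "2 * k - 2 \<le> card (N x)" using card_mono[of "N x" BB] card_BB by simp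
    then show "x \<in> rich b (2 * k - 2)" using AA_side x unfolding rich_def by auto
  qed
  then have 1: "card (AA \<inter> N y0) \<le> card (rich b (2 * k - 2))" by (simp add: card_mono)
  have "BB \<inter> N x0 \<subseteq> rich (\<not> b) (2 * k - 3)"
  proof
    fix x assume x: "x \<in> BB \<inter> N x0"
    have "AA \<subseteq> N x"
    proof
      fix z assume z: "z \<in> AA"
      then have "N x0 \<subseteq> N z" using nested_by_degree[of x0 z] x0 AA_side by auto
      then show "z \<in> N x" using x nbhd_sym by blast
    qed
    then have "2 * k - 3 \<le> card (N x)" using card_mono[of "N x" AA] card_AA by simp
    then show "x \<in> rich (\<not> b) (2 * k - 3)" using BB_side x unfolding rich_def by auto
  qed
  then have 2: "card (BB \<inter> N x0) \<le> card (rich (\<not> b) (2 * k - 3))" by (simp add: card_mono)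
  have "v \<in> AA \<inter> N y0" using v_adj[OF y0(1)] by (simp add: AA_def)
  then have 3: "1 \<le> card (AA \<inter> N y0)" using finAA by (metis One_nat_def Suc_leI card_gt_0_iff empty_iff finite_Int)
  \<comment> \<open>Only the crown in the part of \<open>y0\<close> can be missed, and it has two elements.\<close>
  have 4: "2 * k - 5 \<le> card (AA \<inter> N y0)"
  proof -
    obtain j where j: "j < Suc r" "y0 \<in> B j" using y0(1) unfolding BB_def by blast
    define A' where "A' = (if j < r then A j else {})"
    have "AA \<subseteq> (AA \<inter> N y0) \<union> A'"
    proof
      fix x assume x: "x \<in> AA"
      show "x \<in> (AA \<inter> N y0) \<union> A'"
      proof (cases "x = v")
        case True then show ?thesis using v_adj y0 x by auto
      next
        case False
        then obtain i where i: "i < r" "x \<in> A i" using x unfolding AA_def by blast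
        then show ?thesis using A_adj[of x i y0 j] j x by (cases "i = j") (auto simp: A'_def)
      qed
    qed
    moreover have "card A' \<le> 2" using A_card[of j] unfolding A'_def by simp
    moreover have "finite A'" using finA unfolding A'_def by auto
    ultimately have "card AA \<le> card (AA \<inter> N y0) + 2"
      using card_mono[of "(AA \<inter> N y0) \<union> A'" AA] card_Un_le[of "AA \<inter> N y0" A'] finAA by fastforce
    then show ?thesis using card_AA by simp
  qed
  have 5: "2 * k - 4 \<le> card (BB \<inter> N x0)"
  proof -
    have "\<exists>B'. BB \<subseteq> (BB \<inter> N x0) \<union> B' \<and> card B' \<le> 2 \<and> finite B'"
    proof (cases "x0 = v")
      case True then show ?thesis using v_adj nbhd_sym by (intro exI[of _ "{}"]) auto
    next
      case False
      then obtain i where i: "i < r" "x0 \<in> A i" using x0(1) unfolding AA_def by blast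
      have "BB \<subseteq> (BB \<inter> N x0) \<union> B i"
      proof
        fix z assume z: "z \<in> BB"
        then obtain j where "j < Suc r" "z \<in> B j" unfolding BB_def by blast
        then show "z \<in> (BB \<inter> N x0) \<union> B i" using A_adj[of x0 i z j] i z nbhd_sym by (cases "i = j") auto
      qed
      then show ?thesis using B_card[of i] finB[of i] i by (intro exI[of _ "B i"]) simp
    qed
    then obtain B' where B': "BB \<subseteq> (BB \<inter> N x0) \<union> B'" "card B' \<le> 2" "finite B'" by blast
    have "card BB \<le> card (BB \<inter> N x0) + 2"
      using card_mono[of "(BB \<inter> N x0) \<union> B'" BB] card_Un_le[of "BB \<inter> N x0" B'] finBB B' by fastforce
    then show ?thesis using card_BB by simp
  qed
  show ?thesis using 1 2 3 4 5 unfolding supports_def by (intro exI[of _ b]) auto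
qed

text \<open>
  If too many of the required vertices avoided \<open>w\<close>, one of them, \<open>q\<close>, would be a non-neighbour of \<open>w\<close>
  with larger degree than some neighbour \<open>y\<close> of \<open>w\<close>. By nesting \<open>w \<in> N y \<subseteq> N q\<close>, which is absurd.
\<close>

lemma partners_available:
  assumes "supports b k" "2 \<le> k" "w \<in> rich b (2 * k - 2)"
  shows "2 * k - 4 \<le> card {y \<in> N w. 2 * k - 3 \<le> card (N y)}"
proof (rule ccontr)
  let ?Q = "{y \<in> N w. 2 * k - 3 \<le> card (N y)}"
  assume "\<not> 2 * k - 4 \<le> card ?Q"
  then have less: "card ?Q < 2 * k - 4" by simp
  have fin: "finite ?Q" by simp
  have "2 * k - 2 \<le> card (N w)" using assms(3) unfolding rich_def by simp
  then have "card ?Q < card (N w)" using less by linarith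
  then have "\<not> N w \<subseteq> ?Q" using card_mono[OF fin, of "N w"] by auto
  then obtain y where y: "y \<in> N w" "card (N y) < 2 * k - 3" by fastforce
  have "card ?Q < card (rich (\<not> b) (2 * k - 3))" using less assms(1) unfolding supports_def by simp
  then have "\<not> rich (\<not> b) (2 * k - 3) \<subseteq> ?Q" using card_mono[OF fin, of "rich (\<not> b) (2 * k - 3)"] by auto
  then obtain q where q: "q \<in> rich (\<not> b) (2 * k - 3)" "q \<notin> N w" unfolding rich_def by blast
  have "(y \<in> S) = (\<not> b)" using crossing[OF y(1)] assms(3) unfolding rich_def by simp
  then have "N y \<subseteq> N q" using nested_by_degree[of y q] y(2) q(1) unfolding rich_def by simp
  then show False using y q nbhd_sym by blast
qed

text \<open>
  The part numbers given to the chosen vertices \<open>ps\<close> of one side and \<open>qs\<close> of the other one, in the order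
  of choice: \<open>2, 2, 3, 3, \<dots>\<close> on both sides, except that the vertex at position \<open>2 * k - 6\<close> of \<open>ps\<close> goes to
  the last part. The part \<open>k - 1\<close> thus gets vertices from \<open>qs\<close> only.
\<close>

definition layered :: "nat \<Rightarrow> ('a \<Rightarrow> nat) \<Rightarrow> 'a list \<Rightarrow> 'a list \<Rightarrow> bool" where
  "layered k f ps qs \<longleftrightarrow>
     (\<forall>m<length ps. f (ps ! m) = (if m < 2 * k - 6 then 2 + m div 2 else k)) \<and>
     (\<forall>m<length qs. f (qs ! m) = 2 + m div 2) \<and>
     (\<forall>v\<in>V. v \<notin> set ps \<longrightarrow> v \<notin> set qs \<longrightarrow> f v = 1)"

lemma layered_first:
  assumes "layered k f ps []" "x \<notin> set ps" "y = (if length ps < 2 * k - 6 then 2 + length ps div 2 else k)"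
  shows "layered k (f(x := y)) (ps @ [x]) []"
proof -
  have "ps ! m \<noteq> x" if "m < length ps" for m using assms(2) that nth_mem by metis
  then show ?thesis using assms(1,3) by (auto simp: layered_def nth_append less_Suc_eq)
qed

lemma layered_second:
  assumes "layered k f ps qs" "x \<notin> set ps" "x \<notin> set qs"
  shows "layered k (f(x := 2 + length qs div 2)) ps (qs @ [x])"
proof -
  have "ps ! m \<noteq> x" if "m < length ps" for m using assms(2) that nth_mem by metis
  moreover have "qs ! m \<noteq> x" if "m < length qs" for m using assms(3) that nth_mem by metis
  ultimately show ?thesis using assms(1) by (auto simp: layered_def nth_append less_Suc_eq)
qed

text \<open>
  A vertex in part \<open>j\<close> finds its two neighbours in part \<open>i\<close> with \<open>1 < i < j\<close> among the chosen vertices of the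
  opposite side. In part \<open>1\<close> it finds them by counting: its degree exceeds the number of
  chosen vertices opposite to it by at least two. That no part is empty follows from the domination of the
  last part.
\<close>

lemma two_transitive_layering:
  fixes f :: "'a \<Rightarrow> nat"
  assumes k: "2 \<le> k"
    and ps: "distinct ps" "length ps = Suc (2 * k - 6)" "set ps \<subseteq> rich b (2 * k - 2)"
    and qs: "distinct qs" "length qs = 2 * k - 4" "\<And>p. p \<in> set ps \<Longrightarrow> set qs \<subseteq> N p"
      "\<And>q. q \<in> set qs \<Longrightarrow> 2 * k - 3 \<le> card (N q)"
    and f: "layered k f ps qs"
  shows "two_transitive_partition V E (map (\<lambda>j. {v \<in> V. f v = j}) [1..<k + 1])"
proof -
  have f_ps: "\<And>m. m < length ps \<Longrightarrow> f (ps ! m) = (if m < 2 * k - 6 then 2 + m div 2 else k)"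
    and f_qs: "\<And>m. m < length qs \<Longrightarrow> f (qs ! m) = 2 + m div 2"
    and f_rest: "\<And>v. v \<in> V \<Longrightarrow> v \<notin> set ps \<Longrightarrow> v \<notin> set qs \<Longrightarrow> f v = 1"
    using f unfolding layered_def by auto
  have ps_side: "p \<in> V \<and> (p \<in> S) = b \<and> 2 * k - 2 \<le> card (N p)" if "p \<in> set ps" for p
    using that ps(3) unfolding rich_def by auto
  have top: "ps ! (2 * k - 6) \<in> set ps" using ps(2) by simp
  have qs_side: "q \<in> V \<and> (q \<in> S) = (\<not> b)" if "q \<in> set qs" for q
  proof -
    have "q \<in> N (ps ! (2 * k - 6))" using qs(3) top that by auto
    then show ?thesis using crossing ps_side[OF top] nbhd_V by blast
  qed
  have f_ps2: "2 \<le> f p \<and> f p \<le> k" if p: "p \<in> set ps" for p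
  proof -
    obtain m where "m < length ps" "p = ps ! m" using p unfolding in_set_conv_nth by blast
    then show ?thesis using f_ps[of m] k ps(2) by auto
  qed
  have f_qs2: "2 \<le> f q \<and> f q \<le> k - 1" if q: "q \<in> set qs" for q
  proof -
    obtain m where "m < length qs" "q = qs ! m" using q unfolding in_set_conv_nth by blast
    then show ?thesis using f_qs[of m] k qs(2) by auto
  qed
  have range: "1 \<le> f v \<and> f v \<le> k" if "v \<in> V" for v
    using f_ps2[of v] f_qs2[of v] f_rest[OF that] k by force
  have dom: "2 \<le> card ({v \<in> V. f v = i} \<inter> N v)" if v: "v \<in> V" and i: "1 \<le> i" "i < f v" for v i
  proof -
    have "v \<in> set ps \<or> v \<in> set qs" using f_rest[OF v] i by auto
    then show ?thesis
    proof
      assume p: "v \<in> set ps"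
      show ?thesis
      proof (cases "i = 1")
        case True
        \<comment> \<open>Neighbours outside the chosen vertices are in the first part.\<close>
        have "N v - set qs \<subseteq> {v \<in> V. f v = i} \<inter> N v"
        proof
          fix y assume y: "y \<in> N v - set qs"
          then have "y \<notin> set ps" using crossing[of y v] ps_side[OF p] ps_side[of y] by auto
          then show "y \<in> {v \<in> V. f v = i} \<inter> N v" using y f_rest[of y] nbhd_V True by auto
        qed
        then have "card (N v - set qs) \<le> card ({v \<in> V. f v = i} \<inter> N v)" by (intro card_mono) auto
        moreover have "card (N v) - card (set qs) \<le> card (N v - set qs)" by (rule diff_card_le_card_Diff) simp
        moreover have "card (set qs) = 2 * k - 4" using qs by (simp add: distinct_card)
        ultimately show ?thesis using ps_side[OF p] k by linarith
      next
        case False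
        \<comment> \<open>Positions \<open>m\<close> and \<open>m + 1\<close> are the two that receive the part number \<open>i\<close>.\<close>
        define m where "m = 2 * (i - 2)"
        have "i < k" using i f_ps2[OF p] by simp
        then have m: "m < length qs" "m + 1 < length qs" using qs(2) False i by (auto simp: m_def)
        have "f (qs ! m) = i" "f (qs ! (m + 1)) = i" using f_qs[OF m(1)] f_qs[OF m(2)] False i
          by (auto simp: m_def)
        then have "{qs ! m, qs ! (m + 1)} \<subseteq> {v \<in> V. f v = i} \<inter> N v"
          using qs(3)[OF p] m qs_side by (auto simp del: add_Suc_right)
        moreover have "card {qs ! m, qs ! (m + 1)} = 2" using m qs(1) by (simp add: nth_eq_iff_index_eq)
        ultimately show ?thesis by (metis card_mono finite_Int finite_N)
      qed
    next
      assume q: "v \<in> set qs"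
      show ?thesis
      proof (cases "i = 1")
        case True
        have "N v - set ps \<subseteq> {v \<in> V. f v = i} \<inter> N v"
        proof
          fix y assume y: "y \<in> N v - set ps"
          then have "y \<notin> set qs" using crossing[of y v] qs_side[OF q] qs_side[of y] by auto
          then show "y \<in> {v \<in> V. f v = i} \<inter> N v" using y f_rest[of y] nbhd_V True by auto
        qed
        then have "card (N v - set ps) \<le> card ({v \<in> V. f v = i} \<inter> N v)" by (intro card_mono) auto
        moreover have "card (N v) - card (set ps) \<le> card (N v - set ps)" by (rule diff_card_le_card_Diff) simp
        moreover have "card (set ps) = Suc (2 * k - 6)" using ps by (simp add: distinct_card)
        moreover have "3 \<le> k" using q qs(2) by (cases "k = 2") (use k in auto)
        ultimately show ?thesis using qs(4)[OF q] by linarith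
      next
        case False
        define m where "m = 2 * (i - 2)"
        have "i < k - 1" using i f_qs2[OF q] by simp
        then have m: "m < 2 * k - 6" "m + 1 < 2 * k - 6" using False i by (auto simp: m_def)
        have m': "m < length ps" "m + 1 < length ps" using m ps(2) by auto
        have "f (ps ! m) = i" "f (ps ! (m + 1)) = i" using f_ps[OF m'(1)] f_ps[OF m'(2)] m False i
          by (auto simp: m_def)
        moreover have "ps ! m \<in> set ps" "ps ! (m + 1) \<in> set ps" using m' by auto
        ultimately have "{ps ! m, ps ! (m + 1)} \<subseteq> {v \<in> V. f v = i} \<inter> N v"
          using qs(3) q nbhd_sym ps_side by blast
        moreover have "card {ps ! m, ps ! (m + 1)} = 2" using m' ps(1) by (simp add: nth_eq_iff_index_eq)
        ultimately show ?thesis by (metis card_mono finite_Int finite_N)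
      qed
    qed
  qed
  have ne: "{v \<in> V. f v = j} \<noteq> {}" if j: "1 \<le> j" "j \<le> k" for j
  proof -
    have f_top: "f (ps ! (2 * k - 6)) = k" using f_ps[of "2 * k - 6"] ps(2) by simp
    show ?thesis
    proof (cases "j = k")
      case True then show ?thesis using f_top ps_side[OF top] by auto
    next
      case False
      then have "2 \<le> card ({v \<in> V. f v = j} \<inter> N (ps ! (2 * k - 6)))"
        using dom[of "ps ! (2 * k - 6)" j] f_top ps_side[OF top] j by auto
      then show ?thesis by force
    qed
  qed
  have inj: "inj_on (\<lambda>j. {v \<in> V. f v = j}) {1..<k + 1}"
  proof (rule inj_onI)
    fix i j assume "i \<in> {1..<k + 1}" "j \<in> {1..<k + 1}" "{v \<in> V. f v = i} = {v \<in> V. f v = j}"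
    then show "i = j" using ne[of i] by auto
  qed
  show ?thesis
    unfolding two_transitive_partition_def
  proof (intro conjI)
    show "partition_on V (set (map (\<lambda>j. {v \<in> V. f v = j}) [1..<k + 1]))"
      using range ne unfolding partition_on_def disjoint_def
      by (fastforce simp del: upt_Suc)
    show "distinct (map (\<lambda>j. {v \<in> V. f v = j}) [1..<k + 1])"
      using inj by (simp add: distinct_map del: upt_Suc)
    show "sorted_wrt (two_dominates E) (map (\<lambda>j. {v \<in> V. f v = j}) [1..<k + 1])"
      using dom by (auto simp: sorted_wrt_iff_nth_less two_dominates_def simp del: upt_Suc)
  qed
qed

end

text \<open>
  All neighbourhoods on the side of \<open>u\<close> are contained in that of \<open>u\<close>, so the vertices outside
  \<open>nbhd E u\<close> are those of the side of \<open>u\<close> together with isolated ones. Moving isolated vertices to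
  the other side harms neither bipartiteness nor nesting.
\<close>

lemma chain_bigraph_of_max_degree:
  assumes "bipartite_chain_graph V E" "u \<in> V" "\<And>v. v \<in> V \<Longrightarrow> card (nbhd E v) \<le> card (nbhd E u)"
  shows "chain_bigraph V E (nbhd E u)"
proof -
  obtain xs ys where G: "simple_graph V E" "bipartition V E (set xs) (set ys)"
    "sorted_wrt (\<lambda>u v. nbhd E v \<subseteq> nbhd E u) xs" "sorted_wrt (\<lambda>u v. nbhd E v \<subseteq> nbhd E u) ys"
    using assms(1) unfolding bipartite_chain_graph_def by blast
  have comparable: "nbhd E v \<subseteq> nbhd E w \<or> nbhd E w \<subseteq> nbhd E v"
    if zs: "sorted_wrt (\<lambda>u v. nbhd E v \<subseteq> nbhd E u) zs" and "v \<in> set zs" "w \<in> set zs" for zs v w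
  proof -
    obtain i j where "i < length zs" "v = zs ! i" "j < length zs" "w = zs ! j"
      using \<open>v \<in> set zs\<close> \<open>w \<in> set zs\<close> by (metis in_set_conv_nth)
    then show ?thesis using zs by (cases i j rule: linorder_cases) (auto simp: sorted_wrt_iff_nth_less)
  qed
  have fin_V: "finite V" using G(1) unfolding simple_graph_def by simp
  have edges: "e \<subseteq> V" if "e \<in> E" for e
    using G(1) that unfolding simple_graph_def by simp
  have sub: "nbhd E v \<subseteq> V" for v using edges unfolding nbhd_def by auto
  have fin: "finite (nbhd E v)" for v
    by (rule finite_subset[OF sub fin_V])
  have sym: "w \<in> nbhd E v \<longleftrightarrow> v \<in> nbhd E w" for v w by (simp add: nbhd_def insert_commute)
  obtain A B where AB: "A \<union> B = V" "A \<inter> B = {}" "u \<in> A"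
    and edge: "\<And>v w. w \<in> nbhd E v \<Longrightarrow> v \<in> A \<and> w \<in> B \<or> v \<in> B \<and> w \<in> A"
    and compA: "\<And>v w. v \<in> A \<Longrightarrow> w \<in> A \<Longrightarrow> nbhd E v \<subseteq> nbhd E w \<or> nbhd E w \<subseteq> nbhd E v"
    and compB: "\<And>v w. v \<in> B \<Longrightarrow> w \<in> B \<Longrightarrow> nbhd E v \<subseteq> nbhd E w \<or> nbhd E w \<subseteq> nbhd E v"
  proof -
    have edge: "v \<in> set xs \<and> w \<in> set ys \<or> v \<in> set ys \<and> w \<in> set xs" if "w \<in> nbhd E v" for v w
      using that G(2) unfolding bipartition_def nbhd_def by (force simp: doubleton_eq_iff)
    show thesis
    proof (cases "u \<in> set xs")
      case True
      then show thesis using that[of "set xs" "set ys"] edge comparable[OF G(3)] comparable[OF G(4)] G(2)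
        unfolding bipartition_def by blast
    next
      case False
      then show thesis using that[of "set ys" "set xs"] edge comparable[OF G(3)] comparable[OF G(4)] G(2) assms(2)
        unfolding bipartition_def by blast
    qed
  qed
  have max: "nbhd E v \<subseteq> nbhd E u" if "v \<in> A" for v
  proof -
    have "card (nbhd E v) \<le> card (nbhd E u)" using assms(3)[of v] that AB by auto
    then show ?thesis using compA[OF that AB(3)] card_seteq[OF fin, of "nbhd E u" v] by blast
  qed
  have SB: "nbhd E u \<subseteq> B" using edge[of _ u] AB by blast
  have isolated: "nbhd E v = {}" if "v \<notin> nbhd E u" "v \<notin> A" for v
  proof (rule ccontr)
    assume "nbhd E v \<noteq> {}"
    then obtain w where w: "w \<in> nbhd E v" by blast
    then have "w \<in> A" using edge[OF w] that AB by blast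
    then show False using max[of w] w sym that by blast
  qed
  show ?thesis
  proof
    show "finite V" by (rule fin_V)
    show "nbhd E v \<subseteq> V" for v by (rule sub)
    show "(w \<in> nbhd E u) = (v \<notin> nbhd E u)" if "w \<in> nbhd E v" for v w
      using edge[OF that]
    proof
      assume "v \<in> A \<and> w \<in> B"
      then show ?thesis using max[of v] that SB AB by blast
    next
      assume vw: "v \<in> B \<and> w \<in> A"
      have "v \<in> nbhd E w" using that sym by simp
      then show ?thesis using max[of w] vw SB AB by blast
    qed
    show "nbhd E v \<subseteq> nbhd E w \<or> nbhd E w \<subseteq> nbhd E v" if "(v \<in> nbhd E u) = (w \<in> nbhd E u)" for v w
    proof (cases "v \<in> nbhd E u")
      case True
      then show ?thesis using that SB compB[of v w] by auto
    next
      case False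
      then show ?thesis using that compA[of v w] isolated[of v] isolated[of w] by auto
    qed
  qed
qed

lemma Tr2_eq:
  assumes "two_transitive_partition V E Vs"
    and "\<And>Vs'. two_transitive_partition V E Vs' \<Longrightarrow> length Vs' \<le> length Vs"
  shows "Tr2 V E = length Vs"
  unfolding Tr2_def
proof (rule Max_eqI)
  show "finite {length Vs' |Vs'. two_transitive_partition V E Vs'}"
    by (rule finite_subset[of _ "{..length Vs}"]) (use assms(2) in auto)
qed (use assms in auto)

section \<open>Reasoning about running programs\<close>

definition runs :: "com \<Rightarrow> state \<Rightarrow> nat \<Rightarrow> (state \<Rightarrow> bool) \<Rightarrow> bool" where
  "runs c s B Q \<longleftrightarrow> (\<exists>t s'. exec c s t s' \<and> t \<le> B \<and> Q s')"

primrec regs_written :: "com \<Rightarrow> name set" where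
  "regs_written Skip = {}"
| "regs_written (Assign x e) = {x}"
| "regs_written (Write a i e) = {}"
| "regs_written (Seq c c') = regs_written c \<union> regs_written c'"
| "regs_written (Cond b c c') = regs_written c \<union> regs_written c'"
| "regs_written (While b c) = regs_written c"

primrec arrs_written :: "com \<Rightarrow> name set" where
  "arrs_written Skip = {}"
| "arrs_written (Assign x e) = {}"
| "arrs_written (Write a i e) = {a}"
| "arrs_written (Seq c c') = arrs_written c \<union> arrs_written c'"
| "arrs_written (Cond b c c') = arrs_written c \<union> arrs_written c'"
| "arrs_written (While b c) = arrs_written c"

text \<open>
  Reading frame conditions off the syntax once keeps them out of the loop invariants.
\<close>

definition unchanged :: "com \<Rightarrow> state \<Rightarrow> state \<Rightarrow> bool" where
  "unchanged c s s' \<longleftrightarrow> (\<forall>x. x \<notin> regs_written c \<longrightarrow> reg s' x = reg s x) \<and>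
     (\<forall>a. a \<notin> arrs_written c \<longrightarrow> arr s' a = arr s a)"

lemma exec_unchanged: "exec c s t s' \<Longrightarrow> unchanged c s s'"
  by (induction rule: exec.induct) (auto simp: unchanged_def)

lemma runs_weaken:
  "runs c s B Q \<Longrightarrow> B \<le> B' \<Longrightarrow> (\<And>s'. unchanged c s s' \<Longrightarrow> Q s' \<Longrightarrow> Q' s') \<Longrightarrow> runs c s B' Q'"
  unfolding runs_def using exec_unchanged le_trans by metis

lemma runs_Seq:
  assumes "runs c s B P" "\<And>s'. unchanged c s s' \<Longrightarrow> P s' \<Longrightarrow> runs c' s' B' Q"
  shows "runs (Seq c c') s (B + B' + 1) Q"
proof -
  obtain t s' where "exec c s t s'" "t \<le> B" "P s'" using assms(1) unfolding runs_def by blast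
  moreover from this obtain t' s'' where "exec c' s' t' s''" "t' \<le> B'" "Q s''"
    using assms(2)[of s'] exec_unchanged unfolding runs_def by blast
  ultimately show ?thesis unfolding runs_def by (meson exec.Seq add_le_mono le_refl)
qed

lemma runs_CondTrue:
  assumes "bval b s" "runs c s B Q"
  shows "runs (Cond b c c') s (bcost b + B + 1) Q"
  using assms exec.CondTrue unfolding runs_def by (meson add_le_mono le_refl)

lemma runs_CondFalse:
  assumes "\<not> bval b s" "runs c' s B Q"
  shows "runs (Cond b c c') s (bcost b + B + 1) Q"
  using assms exec.CondFalse unfolding runs_def by (meson add_le_mono le_refl)

primrec straight :: "com \<Rightarrow> bool" where
  "straight Skip = True"
| "straight (Assign x e) = True"
| "straight (Write a i e) = True"
| "straight (Seq c c') = (straight c \<and> straight c')"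
| "straight (Cond b c c') = (straight c \<and> straight c')"
| "straight (While b c) = False"

text \<open>
  Programs without loops are verified by evaluation: the simplifier computes their final state and an
  upper bound for their running time.
\<close>

primrec effect :: "com \<Rightarrow> state \<Rightarrow> state" where
  "effect Skip s = s"
| "effect (Assign x e) s = s\<lparr>reg := (reg s)(x := aval e s)\<rparr>"
| "effect (Write a i e) s = s\<lparr>arr := (arr s)(a := (arr s a)(aval i s := aval e s))\<rparr>"
| "effect (Seq c c') s = effect c' (effect c s)"
| "effect (Cond b c c') s = (if bval b s then effect c s else effect c' s)"
| "effect (While b c) s = s"

primrec worst_cost :: "com \<Rightarrow> nat" where
  "worst_cost Skip = 1"
| "worst_cost (Assign x e) = acost e + 1"
| "worst_cost (Write a i e) = acost i + acost e + 1"
| "worst_cost (Seq c c') = worst_cost c + worst_cost c' + 1"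
| "worst_cost (Cond b c c') = bcost b + max (worst_cost c) (worst_cost c') + 1"
| "worst_cost (While b c) = 0"

lemma straight_exec: "straight c \<Longrightarrow> \<exists>t. exec c s t (effect c s) \<and> t \<le> worst_cost c"
proof (induction c arbitrary: s)
  case (Seq c c')
  obtain t where t: "exec c s t (effect c s)" "t \<le> worst_cost c" using Seq by auto
  obtain t' where "exec c' (effect c s) t' (effect c' (effect c s))" "t' \<le> worst_cost c'"
    using Seq by (metis straight.simps(4))
  with t show ?case using exec.Seq[OF t(1)] by fastforce
next
  case (Cond b c c')
  show ?case
  proof (cases "bval b s")
    case True
    obtain t where "exec c s t (effect c s)" "t \<le> worst_cost c" using Cond by auto
    then show ?thesis using exec.CondTrue[OF True] True
      by (intro exI[of _ "bcost b + t + 1"]) auto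
  next
    case False
    obtain t where "exec c' s t (effect c' s)" "t \<le> worst_cost c'" using Cond by auto
    then show ?thesis using exec.CondFalse[OF False] False
      by (intro exI[of _ "bcost b + t + 1"]) auto
  qed
qed (auto intro: exec.intros)

lemma runs_straight: "straight c \<Longrightarrow> Q (effect c s) \<Longrightarrow> runs c s (worst_cost c) Q"
  using straight_exec unfolding runs_def by blast

text \<open>
  The potential \<open>\<Phi>\<close> pays for the remaining iterations. The bound \<open>B\<close> for the body may vary with the
  state, as needed for nested loops whose total cost is amortised.
\<close>

lemma runs_While:
  assumes "I s"
    and step: "\<And>s'. unchanged c s s' \<Longrightarrow> I s' \<Longrightarrow> bval b s' \<Longrightarrow>
      \<exists>B. runs c s' B (\<lambda>s''. I s'' \<and> \<Phi> s'' + B + bcost b + 1 \<le> \<Phi> s')"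
    and exit: "\<And>s'. unchanged c s s' \<Longrightarrow> I s' \<Longrightarrow> \<not> bval b s' \<Longrightarrow> Q s'"
  shows "runs (While b c) s (\<Phi> s + bcost b + 1) Q"
proof -
  have "runs (While b c) s' (\<Phi> s' + bcost b + 1) Q" if "I s'" "unchanged c s s'" for s'
    using that
  proof (induction "\<Phi> s'" arbitrary: s' rule: less_induct)
    case less
    show ?case
    proof (cases "bval b s'")
      case False
      then show ?thesis using exec.WhileFalse[OF False] exit less.prems unfolding runs_def
        by (metis le_add2 add.assoc)
    next
      case True
      obtain B t s'' where c: "exec c s' t s''" "t \<le> B" "I s''" "\<Phi> s'' + B + bcost b + 1 \<le> \<Phi> s'"
        using step[OF less.prems(2,1) True] unfolding runs_def by blast
      have "unchanged c s s''"
        using less.prems(2) exec_unchanged[OF c(1)] by (simp add: unchanged_def)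
      then obtain t' r where w: "exec (While b c) s'' t' r" "t' \<le> \<Phi> s'' + bcost b + 1" "Q r"
        using less.hyps[of s''] c unfolding runs_def by auto
      have "exec (While b c) s' (bcost b + t + t' + 1) r"
        by (rule exec.WhileTrue[OF True c(1) w(1)])
      moreover have "bcost b + t + t' + 1 \<le> \<Phi> s' + bcost b + 1" using c w by linarith
      ultimately show ?thesis using w(3) unfolding runs_def by blast
    qed
  qed
  then show ?thesis using assms(1) by (simp add: unchanged_def)
qed

lemma runs_straight_loop:
  assumes "straight c" "I s"
    and step: "\<And>s'. unchanged c s s' \<Longrightarrow> I s' \<Longrightarrow> bval b s' \<Longrightarrow>
      I (effect c s') \<and> \<mu> (effect c s') < \<mu> s'"
    and exit: "\<And>s'. unchanged c s s' \<Longrightarrow> I s' \<Longrightarrow> \<not> bval b s' \<Longrightarrow> Q s'"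
  shows "runs (While b c) s ((\<mu> s + 1) * (worst_cost c + bcost b + 1)) Q"
proof -
  let ?K = "worst_cost c + bcost b + 1"
  have "runs (While b c) s (\<mu> s * ?K + bcost b + 1) Q"
  proof (rule runs_While[where I = I and \<Phi> = "\<lambda>s. \<mu> s * ?K"])
    fix s' assume s': "unchanged c s s'" "I s'" "bval b s'"
    have "Suc (\<mu> (effect c s')) * ?K \<le> \<mu> s' * ?K"
      using step[OF s'] by (intro mult_le_mono1) simp
    then show "\<exists>B. runs c s' B (\<lambda>s''. I s'' \<and> \<mu> s'' * ?K + B + bcost b + 1 \<le> \<mu> s' * ?K)"
      using step[OF s'] assms(1) by (intro exI[of _ "worst_cost c"] runs_straight) auto
  qed (use assms in auto)
  then show ?thesis by (rule runs_weaken) auto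
qed

text \<open>
  The common form of a loop: initialisation by straight-line code, then a loop with straight-line body
  whose measure \<open>\<mu>\<close> bounds the number of iterations.
\<close>

lemma runs_loop:
  assumes "straight init" "straight c" "I (effect init s)"
    and step: "\<And>s'. unchanged (Seq init (While b c)) s s' \<Longrightarrow> I s' \<Longrightarrow> bval b s' \<Longrightarrow>
      I (effect c s') \<and> \<mu> (effect c s') < \<mu> s'"
    and exit: "\<And>s'. unchanged (Seq init (While b c)) s s' \<Longrightarrow> I s' \<Longrightarrow> \<not> bval b s' \<Longrightarrow> Q s'"
    and cost: "worst_cost init + (\<mu> (effect init s) + 1) * (worst_cost c + bcost b + 1) + 1 \<le> B"
  shows "runs (Seq init (While b c)) s B Q"
proof (rule runs_weaken[OF runs_Seq[OF runs_straight[where Q = "\<lambda>s'. s' = effect init s"], where Q = Q]])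

  show "straight init" by fact
  show "effect init s = effect init s" by simp
  fix s1 assume init: "unchanged init s s1" "s1 = effect init s"
  have trans: "unchanged (Seq init (While b c)) s s'" if "unchanged c s1 s'" for s'
    using init(1) that by (auto simp: unchanged_def)
  show "runs (While b c) s1 ((\<mu> (effect init s) + 1) * (worst_cost c + bcost b + 1)) Q"
    unfolding init(2)[symmetric]
    using assms(2,3) init(2) step exit trans
    by (intro runs_straight_loop[where I = I]) auto
qed (use cost in auto)

section \<open>The program\<close>

abbreviation seq (infixr ";;" 60) where "c ;; c' \<equiv> Seq c c'"

definition degree_of :: "aexp \<Rightarrow> aexp" where
  "degree_of e = Minus (Read ''start'' (Succ e)) (Read ''start'' e)"

abbreviation increment :: "name \<Rightarrow> com" where
  "increment x \<equiv> Assign x (Succ (Var x))"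

definition hub_step :: com where
  "hub_step =
     Cond (Less (degree_of (Var ''u'')) (degree_of (Var ''i''))) (Assign ''u'' (Var ''i'')) Skip ;;
     increment ''i''"

definition find_hub :: com where
  "find_hub =
     (Assign ''u'' (Lit 0) ;; Assign ''i'' (Lit 0)) ;;
     While (Less (Var ''i'') (Var ''n'')) hub_step"

text \<open>
  With a vertex \<open>u\<close> of maximum degree, \<open>side\<close> is set to \<open>1\<close> on the neighbours of \<open>u\<close> and stays \<open>0\<close> elsewhere.
\<close>

definition mark_step :: com where
  "mark_step = Write ''side'' (Read ''adj'' (Var ''i'')) (Lit 1) ;; increment ''i''"

definition mark_side :: com where
  "mark_side =
     Assign ''i'' (Read ''start'' (Var ''u'')) ;;
     While (Less (Var ''i'') (Read ''start'' (Succ (Var ''u'')))) mark_step"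

text \<open>
  The \<open>d\<close>-th cell in the list of a vertex increments the \<open>d\<close>-th counter of its side. So \<open>c0[d]\<close> and \<open>c1[d]\<close>
  end up as the numbers of vertices of degree at least \<open>d\<close> on the two sides, without any addition.
\<close>

definition tally_step :: com where
  "tally_step =
     increment ''d'' ;;
     Cond (Less (Read ''side'' (Var ''v'')) (Lit 1))
       (Write ''c0'' (Var ''d'') (Succ (Read ''c0'' (Var ''d''))))
       (Write ''c1'' (Var ''d'') (Succ (Read ''c1'' (Var ''d'')))) ;;
     increment ''i''"

definition tally_vertex :: com where
  "tally_vertex =
     (Assign ''d'' (Lit 0) ;;
      While (Less (Var ''i'') (Read ''start'' (Succ (Var ''v'')))) tally_step) ;;
     increment ''v''"

definition tally_degrees :: com where
  "tally_degrees =
     (Assign ''v'' (Lit 0) ;; Assign ''i'' (Lit 0)) ;;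
     While (Less (Var ''v'') (Var ''n'')) tally_vertex"

text \<open>
  The condition \<open>supports\<close> for the number of parts \<open>k\<close> with \<open>j = 2k - 2\<close>, where \<open>p\<close> and \<open>q\<close> name the counters
  of the side of the last part and of the other side.
\<close>

definition supported_test :: "name \<Rightarrow> name \<Rightarrow> bexp" where
  "supported_test p q =
     And (Less (Lit 0) (Read p (Var ''j'')))
      (And (Not (Less (Read p (Var ''j'')) (Minus (Var ''j'') (Lit 3))))
        (Not (Less (Read q (Minus (Var ''j'') (Lit 1))) (Minus (Var ''j'') (Lit 2)))))"

text \<open>
  During the search \<open>j = 2k\<close>, which makes the test one about \<open>k + 1\<close> parts.
\<close>

definition grow_step :: com where
  "grow_step = increment ''k'' ;; increment ''j'' ;; increment ''j''"

definition find_size :: com where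
  "find_size =
     (Assign ''k'' (Lit 1) ;; Assign ''j'' (Lit 2)) ;;
     While (Not (And (Not (supported_test ''c0'' ''c1'')) (Not (supported_test ''c1'' ''c0'')))) grow_step"

text \<open>
  Back to \<open>j = 2k - 2\<close>, so that the test is about \<open>k\<close> itself.
\<close>

definition choose_side :: com where
  "choose_side =
     Assign ''j'' (Minus (Var ''j'') (Lit 2)) ;;
     Cond (supported_test ''c0'' ''c1'') (Assign ''p'' (Lit 0)) (Assign ''p'' (Lit 1))"

definition clear_step :: com where
  "clear_step = Write ''part'' (Var ''i'') (Lit 1) ;; increment ''i''"

definition clear_parts :: com where
  "clear_parts = Assign ''i'' (Lit 0) ;; While (Less (Var ''i'') (Var ''n'')) clear_step"

text \<open>
  The sequence \<open>2, 2, 3, 3, \<dots>\<close> without division: after \<open>m\<close> choices \<open>a = 2 + m div 2\<close> is the next part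
  number and \<open>b = 2 + (m + 1) div 2\<close> the one after it.
\<close>

definition next_part :: com where
  "next_part =
     increment ''m'' ;;
     Assign ''t'' (Succ (Var ''a'')) ;; Assign ''a'' (Var ''b'') ;; Assign ''b'' (Var ''t'')"

text \<open>
  The two negated comparisons at the end express that \<open>i\<close> lies on the side \<open>p\<close>.
\<close>

definition first_test :: bexp where
  "first_test =
     And (Less (Var ''m'') (Succ (Var ''h'')))
      (And (Not (Less (degree_of (Var ''i'')) (Var ''j'')))
        (And (Not (Less (Read ''side'' (Var ''i'')) (Var ''p'')))
          (Not (Less (Var ''p'') (Read ''side'' (Var ''i''))))))"

definition first_step :: com where
  "first_step =
     Cond first_test
       (Cond (Less (Var ''m'') (Var ''h''))
          (Write ''part'' (Var ''i'') (Var ''a'')) (Write ''part'' (Var ''i'') (Var ''k'')) ;;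
        Cond (Less (degree_of (Var ''w'')) (degree_of (Var ''i''))) Skip (Assign ''w'' (Var ''i'')) ;;
        next_part)
       Skip ;;
     increment ''i''"

text \<open>
  The register \<open>w\<close> collects a chosen vertex of least degree. It starts as \<open>u\<close>, whose degree is maximal,
  so that the first choice certainly replaces it. With \<open>h = 2k - 6\<close> there are \<open>h + 1\<close> places, the last
  of which is the one in part \<open>k\<close>; the truncated subtraction makes this right for \<open>k = 2\<close>, too.
\<close>

definition place_first :: com where
  "place_first =
     (Assign ''h'' (Minus (Var ''j'') (Lit 4)) ;; Assign ''w'' (Var ''u'') ;; Assign ''m'' (Lit 0) ;;
      Assign ''a'' (Lit 2) ;; Assign ''b'' (Lit 2) ;; Assign ''i'' (Lit 0)) ;;
     While (Less (Var ''i'') (Var ''n'')) first_step"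

definition second_step :: com where
  "second_step =
     Assign ''x'' (Read ''adj'' (Var ''i'')) ;;
     Cond (And (Less (Var ''m'') (Minus (Var ''j'') (Lit 2)))
            (Not (Less (degree_of (Var ''x'')) (Minus (Var ''j'') (Lit 1)))))
       (Write ''part'' (Var ''x'') (Var ''a'') ;; next_part)
       Skip ;;
     increment ''i''"

text \<open>
  Scanning the list of \<open>w\<close> instead of all vertices ensures that the choices are adjacent to every
  vertex chosen before, since \<open>w\<close> has the least degree among those.
\<close>

definition place_second :: com where
  "place_second =
     (Assign ''m'' (Lit 0) ;; Assign ''a'' (Lit 2) ;; Assign ''b'' (Lit 2) ;;
      Assign ''i'' (Read ''start'' (Var ''w''))) ;;
     While (Less (Var ''i'') (Read ''start'' (Succ (Var ''w'')))) second_step"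

definition place_seeds :: com where
  "place_seeds =
     Cond (Less (Lit 1) (Var ''k'')) (choose_side ;; place_first ;; place_second) Skip"

definition partition_graph :: com where
  "partition_graph =
     mark_side ;; tally_degrees ;; find_size ;; clear_parts ;; place_seeds"

definition max_two_transitive_partition :: com where
  "max_two_transitive_partition =
     Cond (Less (Lit 0) (Var ''n'')) (find_hub ;; partition_graph) Skip"

section \<open>Correctness and running time\<close>

lemmas block_defs =
  find_hub_def hub_step_def mark_side_def mark_step_def tally_degrees_def tally_vertex_def
  tally_step_def find_size_def grow_step_def choose_side_def clear_parts_def clear_step_def
  place_first_def first_step_def place_second_def second_step_def next_part_def

locale stored_chain_graph =
  fixes n :: nat and E :: "nat set set" and adj :: "nat list list"
  assumes chain: "bipartite_chain_graph {..<n} E"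
    and adjacency: "adjacency_lists n E adj"
begin

abbreviation dg :: "nat \<Rightarrow> nat" where "dg v \<equiv> card (nbhd E v)"

text \<open>
  The list of \<open>v\<close> occupies the cells from \<open>offset v\<close> up to \<open>offset (v + 1)\<close>.
\<close>

definition offset :: "nat \<Rightarrow> nat" where
  "offset = array_of (map (\<lambda>v. length (concat (take v adj))) [0..<n + 1])"

definition stored :: "state \<Rightarrow> bool" where
  "stored s \<longleftrightarrow> reg s ''n'' = n \<and> arr s ''start'' = offset \<and> arr s ''adj'' = array_of (concat adj)"

lemma length_adj: "length adj = n"
  using adjacency by (simp add: adjacency_lists_def)

lemma set_adj: "v < n \<Longrightarrow> set (adj ! v) = nbhd E v"
  and distinct_adj: "v < n \<Longrightarrow> distinct (adj ! v)"
  using adjacency by (simp_all add: adjacency_lists_def)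

lemma length_adj_nth: "v < n \<Longrightarrow> length (adj ! v) = dg v"
  using set_adj distinct_adj distinct_card by metis

lemma nbhd_less: "w \<in> nbhd E v \<Longrightarrow> w < n"
  using chain unfolding bipartite_chain_graph_def simple_graph_def nbhd_def by auto

lemma offset_eq: "v \<le> n \<Longrightarrow> offset v = length (concat (take v adj))"
  by (simp add: offset_def array_of_def del: upt_Suc)

lemma offset_0 [simp]: "offset 0 = 0"
  by (simp add: offset_eq)

lemma offset_Suc: "v < n \<Longrightarrow> offset (Suc v) = offset v + dg v"
  by (simp add: offset_eq take_Suc_conv_app_nth length_adj length_adj_nth)

lemma adj_entry:
  assumes "v < n" "i < dg v"
  shows "array_of (concat adj) (offset v + i) = adj ! v ! i"
proof -
  have "adj = take v adj @ adj ! v # drop (Suc v) adj"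
    using assms(1) by (simp add: id_take_nth_drop length_adj)
  then have "concat adj = concat (take v adj) @ adj ! v @ concat (drop (Suc v) adj)"
    by (metis concat.simps(2) concat_append)
  then show ?thesis
    using assms length_adj_nth[OF assms(1)] by (simp add: array_of_def offset_eq nth_append)
qed

lemma adj_entry_nbhd:
  assumes "v < n" "i < dg v"
  shows "adj ! v ! i \<in> nbhd E v"
  using assms set_adj[of v] length_adj_nth[of v] nth_mem[of i "adj ! v"] by simp

text \<open>
  The handshake bound: every edge accounts for at most two cells.
\<close>

lemma offset_n_le: "offset n \<le> 2 * card E"
proof -
  have E: "e \<subseteq> {..<n}" "card e = 2" if "e \<in> E" for e
    using chain that unfolding bipartite_chain_graph_def simple_graph_def by auto
  then have "E \<subseteq> Pow {..<n}" by blast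
  then have fin: "finite E" by (rule finite_subset) simp
  have two: "finite {(v, w). {v, w} = e} \<and> card {(v, w). {v, w} = e} \<le> 2" if "e \<in> E" for e
  proof -
    obtain x y where "e = {x, y}" using E(2)[OF \<open>e \<in> E\<close>] by (metis card_2_iff)
    then have sub: "{(v, w). {v, w} = e} \<subseteq> {(x, y), (y, x)}" by (auto simp: doubleton_eq_iff)
    have fin2: "finite {(x, y), (y, x)}" by simp
    have "card {(x, y), (y, x)} \<le> 2" by (cases "x = y") auto
    then show ?thesis using card_mono[OF fin2 sub] finite_subset[OF sub fin2] by simp
  qed
  have fin_N: "finite (nbhd E v)" for v
    by (rule finite_subset[of _ "{..<n}"]) (use nbhd_less in auto)
  have "offset v = (\<Sum>w<v. dg w)" if "v \<le> n" for v
    using that by (induction v) (auto simp: offset_Suc)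
  then have "offset n = card (SIGMA v:{..<n}. nbhd E v)" using fin_N by simp
  also have "(SIGMA v:{..<n}. nbhd E v) \<subseteq> (\<Union>e\<in>E. {(v, w). {v, w} = e})"
    by (auto simp: nbhd_def)
  then have "card (SIGMA v:{..<n}. nbhd E v) \<le> card (\<Union>e\<in>E. {(v, w). {v, w} = e})"
    by (rule card_mono[rotated]) (use fin two in blast)
  also have "\<dots> \<le> (\<Sum>e\<in>E. card {(v, w). {v, w} = e})" using fin by (rule card_UN_le)
  also have "\<dots> \<le> (\<Sum>e\<in>E. 2)" using two by (intro sum_mono) blast
  finally show ?thesis by (simp add: mult.commute)
qed

lemma degree_of_value:
  assumes "stored s" "aval e s < n"
  shows "aval (degree_of e) s = dg (aval e s)"
  using assms by (simp add: degree_of_def stored_def offset_Suc)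

lemma stored_unchanged:
  assumes "unchanged c s s'" "stored s"
    "''n'' \<notin> regs_written c" "''start'' \<notin> arrs_written c" "''adj'' \<notin> arrs_written c"
  shows "stored s'"
  using assms by (simp add: stored_def unchanged_def)

text \<open>
  The constants in this and the following time bounds are round numbers above the actual costs.
\<close>

lemma find_hub_runs:
  assumes "stored s" "0 < n"
  shows "runs find_hub s (100 * (n + 1)) (\<lambda>s'. reg s' ''u'' < n \<and> (\<forall>v<n. dg v \<le> dg (reg s' ''u'')))"
  unfolding find_hub_def
proof (rule runs_loop[where \<mu> = "\<lambda>s. n - reg s ''i''" and
      I = "\<lambda>s. reg s ''i'' \<le> n \<and> reg s ''u'' < n \<and> (\<forall>v<reg s ''i''. dg v \<le> dg (reg s ''u''))"], goal_cases)
  case (4 s')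
  then have st: "stored s'" using stored_unchanged assms(1) by (force simp: hub_step_def)
  then have n: "reg s' ''n'' = n" by (simp add: stored_def)
  show ?case using 4 st n
    by (auto simp: hub_step_def degree_of_value less_Suc_eq)
next
  case (5 s')
  then have "stored s'" using stored_unchanged assms(1) by (force simp: hub_step_def)
  then show ?case using 5 by (auto simp: stored_def)
qed (use assms in \<open>auto simp: hub_step_def degree_of_def\<close>)

lemma mark_side_runs:
  assumes "stored s" "arr s ''side'' = (\<lambda>_. 0)" "reg s ''u'' = u" "u < n"
  shows "runs mark_side s (100 * (n + 1)) (\<lambda>s'. arr s' ''side'' = (\<lambda>x. of_bool (x \<in> nbhd E u)))"
  unfolding mark_side_def
proof (rule runs_loop[where \<mu> = "\<lambda>s. offset (Suc u) - reg s ''i''" and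
      I = "\<lambda>s. \<exists>e\<le>dg u. reg s ''i'' = offset u + e \<and>
        arr s ''side'' = (\<lambda>x. of_bool (x \<in> set (take e (adj ! u))))"], goal_cases)
  case (4 s')
  then have st: "stored s'" using stored_unchanged assms(1) by (force simp: mark_step_def)
  have u: "reg s' ''u'' = u" using 4(1) assms(3) by (simp add: mark_step_def unchanged_def)
  obtain e where e: "reg s' ''i'' = offset u + e"
    "arr s' ''side'' = (\<lambda>x. of_bool (x \<in> set (take e (adj ! u))))" using 4(2) by blast
  have less: "e < dg u" using 4(3) e u st assms(4) by (simp add: stored_def offset_Suc)
  have "take (Suc e) (adj ! u) = take e (adj ! u) @ [adj ! u ! e]"
    using less length_adj_nth[OF assms(4)] by (simp add: take_Suc_conv_app_nth)
  then show ?case using e st less assms(4) adj_entry[OF assms(4) less]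
    by (auto simp: mark_step_def stored_def offset_Suc fun_eq_iff intro!: exI[of _ "Suc e"])
next
  case (5 s')
  then have st: "stored s'" using stored_unchanged assms(1) by (force simp: mark_step_def)
  have u: "reg s' ''u'' = u" using 5(1) assms(3) by (simp add: mark_step_def unchanged_def)
  obtain e where e: "e \<le> dg u" "reg s' ''i'' = offset u + e"
    "arr s' ''side'' = (\<lambda>x. of_bool (x \<in> set (take e (adj ! u))))" using 5(2) by blast
  then have "e = dg u" using 5(3) u st assms(4) by (simp add: stored_def offset_Suc)
  then show ?case using e set_adj[OF assms(4)] length_adj_nth[OF assms(4)] by simp
next
  case 6
  have "dg u \<le> n" using nbhd_less card_mono[of "{..<n}" "nbhd E u"] by auto
  then show ?case using assms by (auto simp: mark_step_def stored_def offset_Suc)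
qed (use assms in \<open>auto simp: mark_step_def stored_def\<close>)

lemma offset_mono: "v \<le> n \<Longrightarrow> offset v \<le> offset n"
proof (induction rule: inc_induct)
  case (step v)
  then show ?case using offset_Suc[of v] by simp
qed simp

end

locale stored_chain_graph_with_hub = stored_chain_graph +
  fixes u :: nat
  assumes u_less: "u < n" and u_max: "\<And>v. v < n \<Longrightarrow> dg v \<le> dg u"
begin

sublocale chain_bigraph "{..<n}" E "nbhd E u"
  using chain_bigraph_of_max_degree[OF chain] u_less u_max by simp

definition sided :: "state \<Rightarrow> bool" where
  "sided s \<longleftrightarrow> arr s ''side'' = (\<lambda>x. of_bool (x \<in> nbhd E u))"

text \<open>
  The value of the \<open>d\<close>-th counter of side \<open>b\<close> when all vertices below \<open>v\<close> and the first \<open>e\<close> cells of \<open>v\<close>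
  itself have been scanned.
\<close>

definition tally :: "bool \<Rightarrow> nat \<Rightarrow> nat \<Rightarrow> nat \<Rightarrow> nat" where
  "tally b v e d = card {x. x < v \<and> (x \<in> nbhd E u) = b \<and> d \<le> dg x} +
     of_bool ((v \<in> nbhd E u) = b \<and> d \<le> e)"

definition tallied :: "state \<Rightarrow> nat \<Rightarrow> nat \<Rightarrow> bool" where
  "tallied s v e \<longleftrightarrow> (\<forall>d\<ge>1. arr s ''c0'' d = tally False v e d \<and> arr s ''c1'' d = tally True v e d)"

lemma tally_next_vertex:
  assumes "1 \<le> d"
  shows "tally b v (dg v) d = tally b (Suc v) 0 d"
proof -
  let ?X = "\<lambda>v. {x. x < v \<and> (x \<in> nbhd E u) = b \<and> d \<le> dg x}"
  have "?X (Suc v) = (if (v \<in> nbhd E u) = b \<and> d \<le> dg v then insert v (?X v) else ?X v)"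
    by (auto simp: less_Suc_eq)
  moreover have "finite (?X v)" "v \<notin> ?X v" by auto
  ultimately show ?thesis using assms unfolding tally_def by simp
qed

lemma tally_vertex_runs:
  assumes "stored s" "sided s" "reg s ''v'' = v" "v < n" "reg s ''i'' = offset v" "tallied s v 0"
  shows "runs tally_vertex s (100 * (dg v + 1))
    (\<lambda>s'. reg s' ''v'' = Suc v \<and> reg s' ''i'' = offset (Suc v) \<and> tallied s' (Suc v) 0)"
proof -
  let ?L = "While (Less (Var ''i'') (Read ''start'' (Succ (Var ''v'')))) tally_step"
  have "runs (Assign ''d'' (Lit 0) ;; ?L) s (80 * (dg v + 1))
    (\<lambda>s'. reg s' ''v'' = v \<and> reg s' ''i'' = offset (Suc v) \<and> tallied s' v (dg v))"
  proof (rule runs_loop[where \<mu> = "\<lambda>s. offset (Suc v) - reg s ''i''" and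
      I = "\<lambda>s. reg s ''d'' \<le> dg v \<and> reg s ''i'' = offset v + reg s ''d'' \<and> tallied s v (reg s ''d'')"], goal_cases)
    case (4 s')
    then have st: "stored s'" using stored_unchanged assms(1) by (force simp: tally_step_def)
    have v: "reg s' ''v'' = v" using 4(1) assms(3) by (simp add: tally_step_def unchanged_def)
    have sd: "sided s'" using 4(1) assms(2) by (simp add: tally_step_def unchanged_def sided_def)
    have less: "reg s' ''d'' < dg v" using 4 v st assms(4) by (simp add: stored_def offset_Suc)
    show ?case using 4(2) v sd less assms(4)
      by (auto simp: tally_step_def offset_Suc sided_def tallied_def tally_def)
  next
    case (5 s')
    then have st: "stored s'" using stored_unchanged assms(1) by (force simp: tally_step_def)
    have v: "reg s' ''v'' = v" using 5(1) assms(3) by (simp add: tally_step_def unchanged_def)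
    then have "reg s' ''d'' = dg v" using 5(2,3) st assms(4) by (simp add: stored_def offset_Suc)
    then show ?case using 5(2) v assms(4) by (simp add: offset_Suc)
  qed (use assms in \<open>auto simp: tally_step_def tallied_def offset_Suc\<close>)
  then show ?thesis
    unfolding tally_vertex_def
    by (rule runs_weaken[OF runs_Seq[OF _ runs_straight[where Q =
      "\<lambda>s'. reg s' ''v'' = Suc v \<and> reg s' ''i'' = offset (Suc v) \<and> tallied s' (Suc v) 0"]]])
      (auto simp: tallied_def tally_next_vertex)
qed

lemma tally_degrees_runs:
  assumes "stored s" "sided s" "arr s ''c0'' = (\<lambda>_. 0)" "arr s ''c1'' = (\<lambda>_. 0)"
  shows "runs tally_degrees s (200 * (n + offset n + 1))
    (\<lambda>s'. \<forall>d\<ge>1. arr s' ''c0'' d = card (rich False d) \<and> arr s' ''c1'' d = card (rich True d))"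
proof -
  let ?I = "\<lambda>s'. stored s' \<and> sided s' \<and> reg s' ''v'' \<le> n \<and> reg s' ''i'' = offset (reg s' ''v'') \<and> tallied s' (reg s' ''v'') 0"
  \<comment> \<open>One unit for each remaining vertex and each remaining cell; a vertex of degree \<open>d\<close> uses up \<open>d + 1\<close> of them.\<close>
  let ?\<Phi> = "\<lambda>s'. 200 * ((n - reg s' ''v'') + (offset n - reg s' ''i''))"
  let ?Q = "\<lambda>s'. \<forall>d\<ge>1. arr s' ''c0'' d = card (rich False d) \<and> arr s' ''c1'' d = card (rich True d)"
  have loop: "runs (While (Less (Var ''v'') (Var ''n'')) tally_vertex) s0 (?\<Phi> s0 + bcost (Less (Var ''v'') (Var ''n'')) + 1) ?Q"
    if "?I s0" for s0
  proof (rule runs_While[where I = ?I and \<Phi> = ?\<Phi>], goal_cases)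
    case 1 then show ?case by (rule that)
  next
    case (2 s')
    then have v: "reg s' ''v'' < n" by (simp add: stored_def)
    show ?case
      apply (rule exI, rule runs_weaken[OF tally_vertex_runs[of s' "reg s' ''v''"] le_refl])
      using 2 v apply simp_all[6]
      subgoal for s''
        using 2 v stored_unchanged[of tally_vertex s' s''] offset_mono[of "Suc (reg s' ''v'')"]
        by (simp add: offset_Suc unchanged_def sided_def tally_vertex_def tally_step_def)
      done
  next
    case (3 s')
    then have "reg s' ''v'' = n" by (simp add: stored_def)
    then show ?case using 3(2) by (auto simp: tallied_def tally_def rich_def)
  qed
  show ?thesis unfolding tally_degrees_def
  proof (rule runs_weaken[OF runs_Seq[OF runs_straight[where Q = "\<lambda>s'. ?I s' \<and> reg s' ''v'' = 0 \<and> reg s' ''i'' = 0"],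
        where B' = "200 * (n + offset n) + 4" and Q = ?Q]], goal_cases)
    case (3 s')
    then have I: "?I s'" and zero: "reg s' ''v'' = 0" "reg s' ''i'' = 0" by blast+
    show ?case by (rule runs_weaken[OF loop[OF I]]) (use zero in simp_all)
  qed (use assms in \<open>auto simp: stored_def sided_def tallied_def tally_def\<close>)
qed

end

context stored_chain_graph_with_hub
begin

definition counted :: "state \<Rightarrow> bool" where
  "counted s \<longleftrightarrow> (\<forall>d\<ge>1. arr s ''c0'' d = card (rich False d) \<and> arr s ''c1'' d = card (rich True d))"

lemma supported_test_value:
  assumes "counted s" "reg s ''j'' = 2 * k - 2" "2 \<le> k"
  shows "bval (supported_test ''c0'' ''c1'') s = supports False k"
    and "bval (supported_test ''c1'' ''c0'') s = supports True k"
proof -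
  have "1 \<le> 2 * k - 2" "1 \<le> 2 * k - 3" "2 * k - 2 - 1 = 2 * k - 3" using assms(3) by auto
  then show "bval (supported_test ''c0'' ''c1'') s = supports False k"
    and "bval (supported_test ''c1'' ''c0'') s = supports True k"
    using assms(1,2) by (auto simp: supported_test_def counted_def supports_def)
qed

text \<open>
  The search for \<open>k\<close> takes at most linearly many rounds because a supported size needs a vertex of
  large degree.
\<close>

lemma supports_size:
  assumes "supports b k"
  shows "2 * k - 2 \<le> n"
proof -
  have "rich b (2 * k - 2) \<noteq> {}" using assms unfolding supports_def by force
  then obtain v where "2 * k - 2 \<le> dg v" unfolding rich_def by blast
  also have "dg v \<le> n" using card_mono[of "{..<n}" "nbhd E v"] nbhd_V by simp
  finally show ?thesis .
qed

text \<open>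
  The loop stops at the first \<open>k\<close> such that \<open>k + 1\<close> parts are not supported. This is the maximum because
  \<open>partition_supports\<close> applies to any number of parts up to the length of a partition.
\<close>

lemma find_size_runs:
  assumes "counted s"
  shows "runs find_size s (100 * (n + 1)) (\<lambda>s'. 1 \<le> reg s' ''k'' \<and> reg s' ''j'' = 2 * reg s' ''k'' \<and>
    (reg s' ''k'' = 1 \<or> (\<exists>b. supports b (reg s' ''k''))) \<and> (\<forall>b. \<not> supports b (Suc (reg s' ''k''))))"
  unfolding find_size_def
proof (rule runs_loop[where \<mu> = "\<lambda>s. n + 2 - reg s ''j''" and
      I = "\<lambda>s. 1 \<le> reg s ''k'' \<and> reg s ''j'' = 2 * reg s ''k'' \<and>
        (reg s ''k'' = 1 \<or> (\<exists>b. supports b (reg s ''k'')))"], goal_cases)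
  case (4 s')
  have "counted s'" using 4(1) assms by (simp add: grow_step_def unchanged_def counted_def)
  note test = supported_test_value[OF this, of "Suc (reg s' ''k'')"]
  obtain b where b: "supports b (Suc (reg s' ''k''))" using 4(2,3) test by auto
  then show ?case using 4(2) supports_size[OF b] by (auto simp: grow_step_def)
next
  case (5 s')
  have "counted s'" using 5(1) assms by (simp add: grow_step_def unchanged_def counted_def)
  note test = supported_test_value[OF this, of "Suc (reg s' ''k'')"]
  have "\<not> supports b (Suc (reg s' ''k''))" for b using 5(2,3) test by (cases b) auto
  then show ?case using 5(2) by auto
qed (auto simp: grow_step_def supported_test_def)

lemma choose_side_runs:
  assumes "counted s" "reg s ''k'' = k" "reg s ''j'' = 2 * k" "2 \<le> k" "supports b k"
  shows "runs choose_side s 100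
    (\<lambda>s'. reg s' ''j'' = 2 * k - 2 \<and> (\<exists>b. reg s' ''p'' = of_bool b \<and> supports b k))"
proof (rule runs_weaken[OF runs_straight])
  define s1 where "s1 = effect (Assign ''j'' (Minus (Var ''j'') (Lit 2))) s"
  have "counted s1" "reg s1 ''j'' = 2 * k - 2" using assms by (simp_all add: s1_def counted_def)
  note test = supported_test_value[OF this assms(4)]
  have j: "reg (effect choose_side s) ''j'' = 2 * k - 2"
    using assms(3) by (simp add: choose_side_def)
  show "reg (effect choose_side s) ''j'' = 2 * k - 2 \<and>
      (\<exists>b. reg (effect choose_side s) ''p'' = of_bool b \<and> supports b k)"
  proof (cases "supports False k")
    case True
    then have "reg (effect choose_side s) ''p'' = of_bool False"
      using test by (simp add: choose_side_def s1_def)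
    then show ?thesis using True j by blast
  next
    case False
    then have "supports True k" using assms(5) by (cases b) auto
    moreover have "reg (effect choose_side s) ''p'' = of_bool True"
      using test False by (simp add: choose_side_def s1_def)
    ultimately show ?thesis using j by blast
  qed
qed (auto simp: choose_side_def supported_test_def)

lemma clear_parts_runs:
  assumes "stored s"
  shows "runs clear_parts s (100 * (n + 1)) (\<lambda>s'. \<forall>v<n. arr s' ''part'' v = 1)"
  unfolding clear_parts_def
proof (rule runs_loop[where \<mu> = "\<lambda>s. n - reg s ''i''" and
      I = "\<lambda>s. stored s \<and> reg s ''i'' \<le> n \<and> (\<forall>v<reg s ''i''. arr s ''part'' v = 1)"], goal_cases)
qed (use assms in \<open>auto simp: clear_step_def stored_def less_Suc_eq\<close>)

lemma place_first_runs:
  assumes "stored s" "sided s" "reg s ''u'' = u" "reg s ''k'' = k" "2 \<le> k" "reg s ''j'' = 2 * k - 2"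
    "reg s ''p'' = of_bool b" "supports b k" "\<forall>v<n. arr s ''part'' v = 1"
  shows "runs place_first s (200 * (n + 1)) (\<lambda>s'. \<exists>ps. distinct ps \<and> length ps = Suc (2 * k - 6) \<and>
    set ps \<subseteq> rich b (2 * k - 2) \<and> layered k (arr s' ''part'') ps [] \<and>
    reg s' ''w'' \<in> set ps \<and> (\<forall>p\<in>set ps. dg (reg s' ''w'') \<le> dg p))"
proof -
  let ?R = "rich b (2 * k - 2)"
  define inv where "inv s ps \<longleftrightarrow> reg s ''h'' = 2 * k - 6 \<and> reg s ''i'' \<le> n \<and> distinct ps \<and>
    set ps \<subseteq> {v \<in> ?R. v < reg s ''i''} \<and> reg s ''m'' = length ps \<and> length ps \<le> Suc (2 * k - 6) \<and>
    (length ps < Suc (2 * k - 6) \<longrightarrow> set ps = {v \<in> ?R. v < reg s ''i''}) \<and>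
    reg s ''a'' = 2 + length ps div 2 \<and> reg s ''b'' = 2 + Suc (length ps) div 2 \<and>
    layered k (arr s ''part'') ps [] \<and> reg s ''w'' < n \<and> (ps \<noteq> [] \<longrightarrow> reg s ''w'' \<in> set ps) \<and>
    (ps = [] \<longrightarrow> reg s ''w'' = u) \<and> (\<forall>p\<in>set ps. dg (reg s ''w'') \<le> dg p)" for s :: state and ps
  show ?thesis unfolding place_first_def
  proof (rule runs_loop[where \<mu> = "\<lambda>s. n - reg s ''i''" and I = "\<lambda>s. \<exists>ps. inv s ps"], goal_cases)
    case 3
    show ?case using assms u_less by (intro exI[of _ "[]"]) (auto simp: inv_def layered_def)
  next
    case (4 s')
    then have st: "stored s'" using stored_unchanged assms(1) by (force simp: first_step_def next_part_def)
    have fr: "sided s'" "reg s' ''k'' = k" "reg s' ''j'' = 2 * k - 2" "reg s' ''p'' = of_bool b"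
      using 4(1) assms by (simp_all add: first_step_def next_part_def unchanged_def sided_def)
    obtain ps where ps: "inv s' ps" using 4(2) by blast
    let ?i = "reg s' ''i''"
    have i: "?i < n" using 4(3) st by (simp add: stored_def)
    have w: "reg s' ''w'' < n" using ps by (simp add: inv_def)
    have pf: "reg s' ''h'' = 2 * k - 6" "reg s' ''m'' = length ps"
        "reg s' ''a'' = 2 + length ps div 2" "reg s' ''b'' = 2 + Suc (length ps) div 2"
        "length ps \<le> Suc (2 * k - 6)"
      using ps by (simp_all add: inv_def)
    have deg: "arr s' ''start'' (Suc ?i) - arr s' ''start'' ?i = dg ?i"
      "arr s' ''start'' (Suc (reg s' ''w'')) - arr s' ''start'' (reg s' ''w'') = dg (reg s' ''w'')"
      using st i w by (simp_all add: stored_def offset_Suc)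
    have side: "arr s' ''side'' ?i = of_bool (?i \<in> nbhd E u)" using fr(1) by (simp add: sided_def)
    let ?c = "length ps < Suc (2 * k - 6) \<and> ?i \<in> ?R"
    have R: "?i \<in> ?R \<longleftrightarrow> \<not> dg ?i < 2 * k - 2 \<and> (?i \<in> nbhd E u) = b"
      using i by (auto simp: rich_def)
    have test: "bval first_test s' = ?c"
      unfolding R by (simp add: first_test_def degree_of_def deg side fr pf of_bool_def)
    let ?s = "effect first_step s'"
    have frame: "reg ?s ''h'' = 2 * k - 6" "reg ?s ''i'' = Suc ?i"
      using pf by (simp_all add: first_step_def next_part_def)
    show ?case
    proof (cases ?c)
      case False
      then have "\<not> bval first_test s'" using test by simp
      then have "?s = effect (increment ''i'') s'" by (simp add: first_step_def)
      moreover have "inv (effect (increment ''i'') s') ps"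
        using ps False i by (auto simp: inv_def less_Suc_eq)
      ultimately show ?thesis using i by auto
    next
      case True
      have taken: "bval first_test s'" using test True by simp
      have notin: "?i \<notin> set ps" using ps by (auto simp: inv_def)
      have part: "arr ?s ''part'' = (arr s' ''part'')(?i := (if length ps < 2 * k - 6 then 2 + length ps div 2 else k))"
        and regs: "reg ?s ''m'' = Suc (length ps)"
          "reg ?s ''a'' = 2 + Suc (length ps) div 2" "reg ?s ''b'' = 2 + Suc (Suc (length ps)) div 2"
          "reg ?s ''w'' = (if dg (reg s' ''w'') < dg ?i then reg s' ''w'' else ?i)"
        using taken True by (simp_all add: first_step_def next_part_def degree_of_def deg fr pf)
      note regs = regs frame
      have "layered k (arr ?s ''part'') (ps @ [?i]) []"
        unfolding part using ps notin by (intro layered_first) (auto simp: inv_def)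
      then have "inv ?s (ps @ [?i])"
        unfolding inv_def regs using ps True i u_max[of ?i] by (auto simp: inv_def less_Suc_eq)
      then show ?thesis using i regs by auto
    qed
  next
    case (5 s')
    then have "stored s'" using stored_unchanged assms(1) by (force simp: first_step_def next_part_def)
    obtain ps where ps: "inv s' ps" using 5(2) by blast
    have "reg s' ''i'' = n" using ps 5(3) \<open>stored s'\<close> by (simp add: inv_def stored_def)
    have R: "{v \<in> ?R. v < n} = ?R" by (auto simp: rich_def)
    \<comment> \<open>While there is room, every suitable vertex is chosen; so the scan can only end with all places filled.\<close>
    have full: "length ps = Suc (2 * k - 6)"
    proof (rule ccontr)
      assume "length ps \<noteq> Suc (2 * k - 6)"
      then have "length ps < Suc (2 * k - 6)" "set ps = ?R"
        using ps \<open>reg s' ''i'' = n\<close> R by (auto simp: inv_def)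
      moreover have "length ps = card (set ps)" using ps by (simp add: inv_def distinct_card)
      moreover have "Suc (2 * k - 6) \<le> card ?R" using assms(5,8) unfolding supports_def by linarith
      ultimately show False by simp
    qed
    then have "ps \<noteq> []" by auto
    then show ?case using ps full by (auto simp: inv_def)
  next
    case 6
    then show ?case by (simp add: first_step_def first_test_def next_part_def degree_of_def)
  qed (simp_all add: first_step_def next_part_def)
qed

lemma place_second_runs:
  assumes "stored s" "reg s ''k'' = k" "2 \<le> k" "reg s ''j'' = 2 * k - 2" "reg s ''w'' = w"
    "supports b k" "layered k (arr s ''part'') ps []" "set ps \<subseteq> rich b (2 * k - 2)" "w \<in> set ps"
  shows "runs place_second s (200 * (n + 1)) (\<lambda>s'. \<exists>qs. distinct qs \<and> length qs = 2 * k - 4 \<and>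
    set qs \<subseteq> nbhd E w \<and> (\<forall>q\<in>set qs. 2 * k - 3 \<le> dg q) \<and> layered k (arr s' ''part'') ps qs)"
proof -
  let ?R = "\<lambda>e. {y \<in> set (take e (adj ! w)). 2 * k - 3 \<le> dg y}"
  have w: "w < n" "w \<in> rich b (2 * k - 2)" using assms(8,9) by (auto simp: rich_def)
  define inv where "inv s qs e \<longleftrightarrow> e \<le> dg w \<and> reg s ''i'' = offset w + e \<and> distinct qs \<and>
    set qs \<subseteq> ?R e \<and> reg s ''m'' = length qs \<and> length qs \<le> 2 * k - 4 \<and>
    (length qs < 2 * k - 4 \<longrightarrow> set qs = ?R e) \<and>
    reg s ''a'' = 2 + length qs div 2 \<and> reg s ''b'' = 2 + Suc (length qs) div 2 \<and>
    layered k (arr s ''part'') ps qs" for s :: state and qs e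
  show ?thesis unfolding place_second_def
  proof (rule runs_loop[where \<mu> = "\<lambda>s. offset (Suc w) - reg s ''i''" and I = "\<lambda>s. \<exists>qs e. inv s qs e"], goal_cases)
    case 3
    show ?case using assms by (intro exI[of _ "[]"] exI[of _ 0]) (auto simp: inv_def stored_def)
  next
    case (4 s')
    then have st: "stored s'" using stored_unchanged assms(1) by (force simp: second_step_def next_part_def)
    have fr: "reg s' ''k'' = k" "reg s' ''j'' = 2 * k - 2" "reg s' ''w'' = w"
      using 4(1) assms by (simp_all add: second_step_def next_part_def unchanged_def)
    obtain qs e where qs: "inv s' qs e" using 4(2) by blast
    have e: "e < dg w" using 4(3) qs st fr w by (simp add: inv_def stored_def offset_Suc)
    have i: "reg s' ''i'' = offset w + e" using qs by (simp add: inv_def)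
    define x where "x = adj ! w ! e"
    have x: "x \<in> nbhd E w" "x < n" using adj_entry_nbhd[OF w(1) e] nbhd_less unfolding x_def by auto
    have read: "aval (Read ''adj'' (Var ''i'')) s' = x"
      using qs st adj_entry[OF w(1) e] by (simp add: inv_def stored_def x_def)
    define s1 where "s1 = effect (Assign ''x'' (Read ''adj'' (Var ''i''))) s'"
    have s1: "stored s1" "reg s1 ''x'' = x" "reg s1 = (reg s')(''x'' := x)" "arr s1 = arr s'"
      using st read by (simp_all add: s1_def stored_def)
    have deg: "aval (degree_of (Var ''x'')) s1 = dg x"
      using degree_of_value[OF s1(1)] s1(2) x by simp
    have take: "take (Suc e) (adj ! w) = take e (adj ! w) @ [x]"
      using e length_adj_nth[OF w(1)] by (simp add: take_Suc_conv_app_nth x_def)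
    have new: "x \<notin> set (take e (adj ! w))"
      using distinct_adj[OF w(1)] take by (metis distinct_take not_distinct_conv_prefix)
    let ?s = "effect second_step s'"
    have k3: "2 * k - 2 - 1 = 2 * k - 3" "2 * k - 2 - 2 = 2 * k - 4" by auto
    let ?c = "length qs < 2 * k - 4 \<and> 2 * k - 3 \<le> dg x"
    show ?case
    proof (cases ?c)
      case False
      have "?s = effect (increment ''i'') s1"
        unfolding second_step_def effect.simps(4) s1_def[symmetric]
        using False deg fr qs s1 k3 by (auto simp: inv_def)
      then have "inv ?s qs (Suc e)" and "reg ?s ''i'' = offset w + Suc e"
        using qs False e s1 take by (auto simp: inv_def)
      then show ?thesis using e i w by (auto simp: offset_Suc)
    next
      case True
      have part: "arr ?s ''part'' = (arr s' ''part'')(x := 2 + length qs div 2)"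
        and regs: "reg ?s ''i'' = Suc (reg s' ''i'')" "reg ?s ''m'' = Suc (length qs)"
          "reg ?s ''a'' = 2 + Suc (length qs) div 2" "reg ?s ''b'' = 2 + Suc (Suc (length qs)) div 2"
        unfolding second_step_def effect.simps(4) s1_def[symmetric]
        using True deg fr qs s1 k3 by (auto simp: inv_def next_part_def)
      have "x \<notin> set ps"
        using crossing[OF x(1)] assms(8) w(2) by (auto simp: rich_def)
      then have "layered k (arr ?s ''part'') ps (qs @ [x])"
        unfolding part using qs new by (intro layered_second) (auto simp: inv_def)
      then have "inv ?s (qs @ [x]) (Suc e)"
        unfolding inv_def regs using qs True e take new by (auto simp: inv_def)
      then show ?thesis using e i regs(1) w by (auto simp: offset_Suc)
    qed
  next
    case (5 s')
    then have st: "stored s'" using stored_unchanged assms(1) by (force simp: second_step_def next_part_def)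
    have fr: "reg s' ''w'' = w"
      using 5(1) assms by (simp add: second_step_def next_part_def unchanged_def)
    obtain qs e where qs: "inv s' qs e" using 5(2) by blast
    have "e = dg w" using 5(3) qs st fr w by (simp add: inv_def stored_def offset_Suc)
    then have R: "?R e = {y \<in> nbhd E w. 2 * k - 3 \<le> dg y}"
      using set_adj[OF w(1)] length_adj_nth[OF w(1)] by simp
    have full: "length qs = 2 * k - 4"
    proof (rule ccontr)
      assume "length qs \<noteq> 2 * k - 4"
      then have less: "length qs < 2 * k - 4" "set qs = ?R e" using qs by (auto simp: inv_def)
      moreover have "length qs = card (set qs)" using qs by (simp add: inv_def distinct_card)
      moreover have "2 * k - 4 \<le> card (?R e)"
        unfolding R by (rule partners_available[OF assms(6,3) w(2)])
      ultimately show False by simp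
    qed
    have "set qs \<subseteq> {y \<in> nbhd E w. 2 * k - 3 \<le> dg y}" using qs R by (auto simp: inv_def)
    then show ?case using qs full by (auto simp: inv_def)
  next
    case 6
    have "dg w \<le> n" using card_mono[of "{..<n}" "nbhd E w"] nbhd_V by simp
    then show ?case using assms w by (simp add: second_step_def next_part_def degree_of_def stored_def offset_Suc)
  qed (simp_all add: second_step_def next_part_def)
qed

end

context stored_chain_graph_with_hub
begin

text \<open>
  The single part \<open>{..<n}\<close>, which the clearing loop leaves in \<open>part\<close>, is the answer for \<open>k = 1\<close>.
\<close>

lemma place_seeds_runs:
  assumes "stored s" "sided s" "counted s" "reg s ''u'' = u" "reg s ''k'' = k" "1 \<le> k"
    "reg s ''j'' = 2 * k" "k = 1 \<or> (\<exists>b. supports b k)" "\<forall>v<n. arr s ''part'' v = 1"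
  shows "runs place_seeds s (500 * (n + 1))
    (\<lambda>s'. reg s' ''k'' = k \<and> two_transitive_partition {..<n} E (output_parts n s'))"
proof (cases "k = 1")
  case True
  have "{v. v < n \<and> arr s ''part'' v = 1} = {..<n}" using assms(9) by auto
  then have "output_parts n s = [{..<n}]"
    using True assms(5) by (simp add: output_parts_def numeral_2_eq_2)
  moreover have "{..<n} \<noteq> {}" using u_less by auto
  ultimately have "two_transitive_partition {..<n} E (output_parts n s)"
    by (simp add: two_transitive_partition_def partition_on_def)
  then have "runs place_seeds s (bcost (Less (Lit 1) (Var ''k'')) + worst_cost Skip + 1)
      (\<lambda>s'. reg s' ''k'' = k \<and> two_transitive_partition {..<n} E (output_parts n s'))"
    unfolding place_seeds_def using True assms(5)
    by (intro runs_CondFalse runs_straight) auto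
  then show ?thesis by (rule runs_weaken) auto
next
  case False
  then have k: "2 \<le> k" using assms(6) by simp
  obtain b where b: "supports b k" using False assms(8) by blast
  let ?Q = "\<lambda>s'. two_transitive_partition {..<n} E (map (\<lambda>j. {v \<in> {..<n}. arr s' ''part'' v = j}) [1..<k + 1])"
  have "runs (choose_side ;; place_first ;; place_second) s
    (100 + (200 * (n + 1) + 200 * (n + 1) + 1) + 1) ?Q"
  proof (rule runs_Seq[OF choose_side_runs[OF assms(3,5,7) k b]])
    fix s1 assume u1: "unchanged choose_side s s1"
      and "reg s1 ''j'' = 2 * k - 2 \<and> (\<exists>b. reg s1 ''p'' = of_bool b \<and> supports b k)"
    then obtain b where s1: "reg s1 ''j'' = 2 * k - 2" "reg s1 ''p'' = of_bool b" and b: "supports b k"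
      by blast
    have st1: "stored s1" "sided s1" "reg s1 ''u'' = u" "reg s1 ''k'' = k" "\<forall>v<n. arr s1 ''part'' v = 1"
      using u1 assms stored_unchanged[OF u1]
      by (simp_all add: unchanged_def sided_def block_defs)
    show "runs (place_first ;; place_second) s1 (200 * (n + 1) + 200 * (n + 1) + 1) ?Q"
    proof (rule runs_Seq[OF place_first_runs[OF st1(1,2,3,4) k s1 b st1(5)]])
      fix s2 assume u2: "unchanged place_first s1 s2"
        and "\<exists>ps. distinct ps \<and> length ps = Suc (2 * k - 6) \<and> set ps \<subseteq> rich b (2 * k - 2) \<and>
          layered k (arr s2 ''part'') ps [] \<and> reg s2 ''w'' \<in> set ps \<and>
          (\<forall>p\<in>set ps. dg (reg s2 ''w'') \<le> dg p)"
      then obtain ps where ps: "distinct ps" "length ps = Suc (2 * k - 6)" "set ps \<subseteq> rich b (2 * k - 2)"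
        "layered k (arr s2 ''part'') ps []" "reg s2 ''w'' \<in> set ps"
        "\<And>p. p \<in> set ps \<Longrightarrow> dg (reg s2 ''w'') \<le> dg p" by blast
      have st2: "stored s2" "reg s2 ''k'' = k" "reg s2 ''j'' = 2 * k - 2"
        using u2 st1 s1 stored_unchanged[OF u2] by (simp_all add: unchanged_def block_defs)
      show "runs place_second s2 (200 * (n + 1)) ?Q"
      proof (rule runs_weaken[OF place_second_runs[OF st2(1,2) k st2(3) refl b ps(4,3,5)] le_refl])
        fix s3 assume "\<exists>qs. distinct qs \<and> length qs = 2 * k - 4 \<and> set qs \<subseteq> nbhd E (reg s2 ''w'') \<and>
          (\<forall>q\<in>set qs. 2 * k - 3 \<le> dg q) \<and> layered k (arr s3 ''part'') ps qs"
        then obtain qs where qs: "distinct qs" "length qs = 2 * k - 4" "set qs \<subseteq> nbhd E (reg s2 ''w'')"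
          "\<And>q. q \<in> set qs \<Longrightarrow> 2 * k - 3 \<le> dg q" "layered k (arr s3 ''part'') ps qs" by blast
        have "set qs \<subseteq> nbhd E p" if "p \<in> set ps" for p
        proof -
          have "nbhd E (reg s2 ''w'') \<subseteq> nbhd E p"
            using ps(3,5) that by (intro nested_by_degree ps(6)) (auto simp: rich_def)
          then show ?thesis using qs(3) by blast
        qed
        then show "?Q s3" by (rule two_transitive_layering[OF k ps(1,2,3) qs(1,2) _ qs(4,5)])
      qed
    qed
  qed
  then have "runs place_seeds s (bcost (Less (Lit 1) (Var ''k'')) +
      (100 + (200 * (n + 1) + 200 * (n + 1) + 1) + 1) + 1) ?Q"
    unfolding place_seeds_def using k assms(5) by (intro runs_CondTrue) auto
  then show ?thesis
  proof (rule runs_weaken)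
    fix s' assume un: "unchanged place_seeds s s'" and Q: "?Q s'"
    have "reg s' ''k'' = k" using un assms(5) by (simp add: unchanged_def place_seeds_def block_defs)
    then show "reg s' ''k'' = k \<and> two_transitive_partition {..<n} E (output_parts n s')"
      using Q by (simp add: output_parts_def del: upt_Suc)
  qed (use u_less in simp)
qed

lemma partition_graph_runs:
  assumes "stored s" "reg s ''u'' = u" "arr s ''side'' = (\<lambda>_. 0)"
    "arr s ''c0'' = (\<lambda>_. 0)" "arr s ''c1'' = (\<lambda>_. 0)"
  shows "runs partition_graph s (1500 * (n + offset n + 1))
    (\<lambda>s'. two_transitive_partition {..<n} E (output_parts n s') \<and>
      length (output_parts n s') = Tr2 {..<n} E)"
proof -
  let ?Q = "\<lambda>s'. two_transitive_partition {..<n} E (output_parts n s') \<and>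
      length (output_parts n s') = Tr2 {..<n} E"
  have "runs partition_graph s (100 * (n + 1) + (200 * (n + offset n + 1) + (100 * (n + 1) +
      (100 * (n + 1) + 500 * (n + 1) + 1) + 1) + 1) + 1) ?Q"
    unfolding partition_graph_def
  proof (rule runs_Seq[OF mark_side_runs[OF assms(1,3,2) u_less]])
    fix s1 assume u1: "unchanged mark_side s s1" and "arr s1 ''side'' = (\<lambda>x. of_bool (x \<in> nbhd E u))"
    then have sd1: "sided s1" by (simp add: sided_def)
    have st1: "stored s1" "arr s1 ''c0'' = (\<lambda>_. 0)" "arr s1 ''c1'' = (\<lambda>_. 0)" "reg s1 ''u'' = u"
      using u1 assms stored_unchanged[OF u1] by (simp_all add: unchanged_def block_defs)
    show "runs (tally_degrees ;; find_size ;; clear_parts ;; place_seeds) s1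
      (200 * (n + offset n + 1) + (100 * (n + 1) + (100 * (n + 1) + 500 * (n + 1) + 1) + 1) + 1) ?Q"
    proof (rule runs_Seq[OF tally_degrees_runs[OF st1(1) sd1 st1(2,3)]])
      fix s2 assume u2: "unchanged tally_degrees s1 s2"
        and "\<forall>d\<ge>1. arr s2 ''c0'' d = card (rich False d) \<and> arr s2 ''c1'' d = card (rich True d)"
      then have c2: "counted s2" by (simp add: counted_def)
      have st2: "stored s2" "sided s2" "reg s2 ''u'' = u"
        using u2 st1 sd1 stored_unchanged[OF u2] by (simp_all add: unchanged_def sided_def block_defs)
      show "runs (find_size ;; clear_parts ;; place_seeds) s2
        (100 * (n + 1) + (100 * (n + 1) + 500 * (n + 1) + 1) + 1) ?Q"
      proof (rule runs_Seq[OF find_size_runs[OF c2]])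
        fix s3 assume u3: "unchanged find_size s2 s3"
          and "1 \<le> reg s3 ''k'' \<and> reg s3 ''j'' = 2 * reg s3 ''k'' \<and>
            (reg s3 ''k'' = 1 \<or> (\<exists>b. supports b (reg s3 ''k''))) \<and>
            (\<forall>b. \<not> supports b (Suc (reg s3 ''k'')))"
        then obtain k where k: "reg s3 ''k'' = k" "1 \<le> k" "reg s3 ''j'' = 2 * k"
          "k = 1 \<or> (\<exists>b. supports b k)" "\<And>b. \<not> supports b (Suc k)" by blast
        have st3: "stored s3" "sided s3" "counted s3" "reg s3 ''u'' = u"
          using u3 st2 c2 stored_unchanged[OF u3]
          by (simp_all add: unchanged_def sided_def counted_def block_defs)
        show "runs (clear_parts ;; place_seeds) s3 (100 * (n + 1) + 500 * (n + 1) + 1) ?Q"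
        proof (rule runs_Seq[OF clear_parts_runs[OF st3(1)]])
          fix s4 assume u4: "unchanged clear_parts s3 s4" and p: "\<forall>v<n. arr s4 ''part'' v = 1"
          have st4: "stored s4" "sided s4" "counted s4" "reg s4 ''u'' = u" "reg s4 ''k'' = k" "reg s4 ''j'' = 2 * k"
            using u4 st3 k(1,3) stored_unchanged[OF u4]
            by (simp_all add: unchanged_def sided_def counted_def block_defs)
          show "runs place_seeds s4 (500 * (n + 1)) ?Q"
          proof (rule runs_weaken[OF place_seeds_runs[OF st4(1-5) k(2) st4(6) k(4) p] le_refl])
            fix s5 assume s5: "reg s5 ''k'' = k \<and> two_transitive_partition {..<n} E (output_parts n s5)"
            have len: "length (output_parts n s5) = k" using s5 by (simp add: output_parts_def)
            \<comment> \<open>A longer partition would support \<open>k + 1\<close> parts.\<close>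
            have "length Vs \<le> k" if "two_transitive_partition {..<n} E Vs" for Vs
            proof (rule ccontr)
              assume "\<not> length Vs \<le> k"
              then show False using partition_supports[OF that, of "Suc k"] k(2,5) by auto
            qed
            then show "?Q s5" using s5 len Tr2_eq[of "{..<n}" E "output_parts n s5"] by simp
          qed
        qed
      qed
    qed
  qed
  then show ?thesis by (rule runs_weaken) auto
qed

end

context stored_chain_graph
begin

lemma max_two_transitive_partition_runs:
  "runs max_two_transitive_partition (input_state adj) (4000 * (n + card E + 1))
    (\<lambda>s. two_transitive_partition {..<n} E (output_parts n s) \<and>
      length (output_parts n s) = Tr2 {..<n} E)"
proof (cases "n = 0")
  case True
  have triv: "two_transitive_partition {} E Vs \<longleftrightarrow> Vs = []" for Vs :: "nat set list"
    by (cases Vs) (auto simp: two_transitive_partition_def partition_on_def)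
  let ?s = "input_state adj"
  have out: "output_parts n ?s = []" by (simp add: output_parts_def input_state_def)
  have tt: "two_transitive_partition {..<n} E (output_parts n ?s)" using True out triv by simp
  moreover have "Tr2 {..<n} E = length (output_parts n ?s)"
    using tt True out triv by (intro Tr2_eq) simp_all
  ultimately have "runs max_two_transitive_partition ?s
      (bcost (Less (Lit 0) (Var ''n'')) + worst_cost Skip + 1)
      (\<lambda>s. two_transitive_partition {..<n} E (output_parts n s) \<and>
        length (output_parts n s) = Tr2 {..<n} E)"
    unfolding max_two_transitive_partition_def
    using True length_adj by (intro runs_CondFalse runs_straight) (auto simp: input_state_def)
  then show ?thesis by (rule runs_weaken) auto
next
  case False
  let ?s = "input_state adj"
  let ?Q = "\<lambda>s. two_transitive_partition {..<n} E (output_parts n s) \<and>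
      length (output_parts n s) = Tr2 {..<n} E"
  have st: "stored ?s" by (simp add: stored_def input_state_def length_adj offset_def del: upt_Suc)
  have zero: "arr ?s ''side'' = (\<lambda>_. 0)" "arr ?s ''c0'' = (\<lambda>_. 0)" "arr ?s ''c1'' = (\<lambda>_. 0)"
    by (simp_all add: input_state_def)
  have "runs (find_hub ;; partition_graph) ?s (100 * (n + 1) + 1500 * (n + offset n + 1) + 1) ?Q"
  proof (rule runs_Seq[OF find_hub_runs[OF st]])
    fix s' assume un: "unchanged find_hub ?s s'"
      and hub: "reg s' ''u'' < n \<and> (\<forall>v<n. dg v \<le> dg (reg s' ''u''))"
    interpret stored_chain_graph_with_hub n E adj "reg s' ''u''"
      using hub by unfold_locales auto
    show "runs partition_graph s' (1500 * (n + offset n + 1)) ?Q"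
      using un zero stored_unchanged[OF un st]
      by (intro partition_graph_runs) (simp_all add: unchanged_def block_defs)
  qed (use False in simp)
  then have "runs max_two_transitive_partition ?s
      (bcost (Less (Lit 0) (Var ''n'')) + (100 * (n + 1) + 1500 * (n + offset n + 1) + 1) + 1) ?Q"
    unfolding max_two_transitive_partition_def
    using False length_adj by (intro runs_CondTrue) (auto simp: input_state_def)
  then show ?thesis by (rule runs_weaken) (use offset_n_le in auto)
qed

end

theorem corollary28:
  "\<exists>(prog :: com) (T :: nat \<Rightarrow> nat).
     (\<lambda>x. real (T x)) \<in> O(\<lambda>x. real x) \<and>
     (\<forall>(n :: nat) (E :: nat set set) (adj :: nat list list).
        bipartite_chain_graph {..<n} E \<longrightarrow> adjacency_lists n E adj \<longrightarrow>
        (\<exists>t s. exec prog (input_state adj) t s \<and> t \<le> T (card {..<n} + card E) \<and>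
           two_transitive_partition {..<n} E (output_parts n s) \<and>
           length (output_parts n s) = Tr2 {..<n} E))"
proof (intro exI[of _ max_two_transitive_partition] exI[of _ "\<lambda>x. 4000 * (x + 1)"] conjI allI impI)
  show "(\<lambda>x. real (4000 * (x + 1))) \<in> O(\<lambda>x. real x)"
  proof (rule bigoI[of _ 8000])
    show "\<forall>\<^sub>F x in sequentially. norm (real (4000 * (x + 1))) \<le> 8000 * norm (real x)"
      using eventually_ge_at_top[of 1] by eventually_elim simp
  qed
next
  fix n E adj assume "bipartite_chain_graph {..<n} E" "adjacency_lists n E adj"
  then interpret stored_chain_graph n E adj by unfold_locales
  show "\<exists>t s. exec max_two_transitive_partition (input_state adj) t s \<and>
      t \<le> 4000 * (card {..<n} + card E + 1) \<and>
      two_transitive_partition {..<n} E (output_parts n s) \<and>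
      length (output_parts n s) = Tr2 {..<n} E"
    using max_two_transitive_partition_runs unfolding runs_def by simp
qed

end
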